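(* Let $\mathbf h$ be a connected Hopf monoid in the category of species and $\mathbf k$ a quotient Hopf monoid via a morphism $\pi:\mathbf h\to\mathbf k$ (surjective). Then $\mathbf h$ is a cofree left $\mathbf k$-comodule. Moreover, \[ \mathbf h\cong \mathbf k\boldsymbol{\cdot} \mathrm{Hker}(\pi) \] as left $\mathbf k$-comodules (and as species).
   Context: Species are functors from finite sets and bijections to finite-dimensional vector spaces over a field $\mathbb{F}$ of characteristic $0$; connected means $\mathbf h[\emptyset]=\mathbb{F}$. $\boldsymbol{\cdot}$ is the Cauchy product $(\mathbf p\boldsymbol{\cdot}\mathbf q)[I]=\bigoplus_{S\sqcup T=I}\mathbf p[S]\otimes\mathbf q[T]$. For a connected $\mathbf k$, $\mathbf k_+[I]=\mathbf k[I]$ if $I\neq\emptyset$ and $\mathbf k_+[\emptyset]=0$. The right Hopf kernel of a morphism of Hopf monoids $\pi:\mathbf h\to\mathbf k$ is $\mathrm{Hker}(\pi)=\ker\bigl((\pi_+\boldsymbol{\cdot}\mathrm{id})\circ\Delta:\mathbf h\to\mathbf h\boldsymbol{\cdot}\mathbf h\to\mathbf k_+\boldsymbol{\cdot}\mathbf h\bigr)$, where $\Delta$ is the coproduct of $\mathbf h$ and $\pi_+:\mathbf h\to\mathbf k_+$ is $\pi$ followed by the canonical projection $\mathbf k\to\mathbf k_+$. *)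

theory Defs
  imports
    Complex_Main
    "HOL-Library.Function_Algebras"
    "HOL-Library.Infinite_Typeclass"
begin

section \<open>Vector spaces and tensor products\<close>

text \<open>
  A vector space over \<open>'f\<close> is a subspace of an ambient vector space: a pair consisting of the
  scalar multiplication of the ambient space and the carrier.
\<close>

type_synonym ('f, 'v) vsp = "('f \<Rightarrow> 'v \<Rightarrow> 'v) \<times> 'v set"

definition is_vsp :: "('f::field, 'v::ab_group_add) vsp \<Rightarrow> bool" where
  "is_vsp V \<longleftrightarrow> vector_space (fst V) \<and> module.subspace (fst V) (snd V)"

definition finite_dim_vsp :: "('f::field, 'v::ab_group_add) vsp \<Rightarrow> bool" where
  "finite_dim_vsp V \<longleftrightarrow> (\<exists>B. finite B \<and> snd V = module.span (fst V) B)"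

definition linear_map :: "('f, 'v::ab_group_add) vsp \<Rightarrow> ('f, 'w::ab_group_add) vsp \<Rightarrow> ('v \<Rightarrow> 'w) \<Rightarrow> bool" where
  "linear_map V W f \<longleftrightarrow>
     (\<forall>x\<in>snd V. f x \<in> snd W) \<and>
     (\<forall>x\<in>snd V. \<forall>y\<in>snd V. f (x + y) = f x + f y) \<and>
     (\<forall>c. \<forall>x\<in>snd V. f (fst V c x) = fst W c (f x))"

definition bilinear_map ::
    "('f, 'v::ab_group_add) vsp \<Rightarrow> ('f, 'w::ab_group_add) vsp \<Rightarrow> ('f, 'u::ab_group_add) vsp \<Rightarrow> ('v \<Rightarrow> 'w \<Rightarrow> 'u) \<Rightarrow> bool" where
  "bilinear_map V W U b \<longleftrightarrow>
     (\<forall>x\<in>snd V. linear_map W U (b x)) \<and> (\<forall>y\<in>snd W. linear_map V U (\<lambda>x. b x y))"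

abbreviation scalar_vsp :: "('f::field, 'f) vsp" where
  "scalar_vsp \<equiv> ((*), UNIV)"

abbreviation bilinear_form ::
    "('f::field, 'v::ab_group_add) vsp \<Rightarrow> ('f, 'w::ab_group_add) vsp \<Rightarrow> ('v \<Rightarrow> 'w \<Rightarrow> 'f) \<Rightarrow> bool" where
  "bilinear_form V W \<equiv> bilinear_map V W scalar_vsp"

text \<open>
  Since bilinear forms on \<open>V \<times> W\<close> separate the elements of \<open>V \<otimes> W\<close>, the tensor product is
  realised as the span of the evaluation functionals \<open>x \<otimes> y = (B \<mapsto> B x y)\<close> on the space of
  bilinear forms. The universal property is \<open>tensor_universal\<close> below.
\<close>

type_synonym ('f, 'v, 'w) tensor = "('v \<Rightarrow> 'w \<Rightarrow> 'f) \<Rightarrow> 'f"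

definition pure_tensor ::
    "('f::field, 'v::ab_group_add) vsp \<Rightarrow> ('f, 'w::ab_group_add) vsp \<Rightarrow> 'v \<Rightarrow> 'w \<Rightarrow> ('f, 'v, 'w) tensor" where
  "pure_tensor V W x y = (\<lambda>B. if bilinear_form V W B then B x y else 0)"

definition tensor_scale :: "'f::field \<Rightarrow> ('f, 'v, 'w) tensor \<Rightarrow> ('f, 'v, 'w) tensor" where
  "tensor_scale c t = (\<lambda>B. c * t B)"

definition tensor_product ::
    "('f::field, 'v::ab_group_add) vsp \<Rightarrow> ('f, 'w::ab_group_add) vsp \<Rightarrow> ('f, ('f, 'v, 'w) tensor) vsp" where
  "tensor_product V W =
     (tensor_scale, module.span tensor_scale {pure_tensor V W x y | x y. x \<in> snd V \<and> y \<in> snd W})"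

text \<open>\<open>f \<otimes> g : V \<otimes> W \<rightarrow> V' \<otimes> W'\<close>; the first two arguments are \<open>V'\<close> and \<open>W'\<close>.\<close>

definition tensor_map ::
    "('f::field, 'v'::ab_group_add) vsp \<Rightarrow> ('f, 'w'::ab_group_add) vsp \<Rightarrow> ('v \<Rightarrow> 'v') \<Rightarrow> ('w \<Rightarrow> 'w') \<Rightarrow>
     ('f, 'v, 'w) tensor \<Rightarrow> ('f, 'v', 'w') tensor" where
  "tensor_map V' W' f g t =
     (\<lambda>B. if bilinear_form V' W' B then t (\<lambda>x y. B (f x) (g y)) else 0)"


section \<open>Species\<close>

text \<open>
  Finite sets are the finite subsets of an infinite type \<open>'a\<close>. A bijection \<open>I \<rightarrow> J\<close> is given by
  \<open>I\<close> and a function \<open>\<sigma>\<close> that is injective on \<open>I\<close>, with \<open>J = \<sigma> ` I\<close>; \<open>relabel p I \<sigma>\<close> is the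
  induced map \<open>p[I] \<rightarrow> p[J]\<close>. All spaces \<open>p[I]\<close> live in one ambient space, which is no
  restriction (take the direct sum of all \<open>p[I]\<close>).
\<close>

record ('a, 'f, 'v) species =
  scl :: "'f \<Rightarrow> 'v \<Rightarrow> 'v"
  obj :: "'a set \<Rightarrow> 'v set"
  relabel :: "'a set \<Rightarrow> ('a \<Rightarrow> 'a) \<Rightarrow> 'v \<Rightarrow> 'v"

abbreviation val :: "('a, 'f, 'v, 'z) species_scheme \<Rightarrow> 'a set \<Rightarrow> ('f, 'v) vsp" where
  "val p I \<equiv> (scl p, obj p I)"

definition is_species :: "('a::infinite, 'f::field_char_0, 'v::ab_group_add, 'z) species_scheme \<Rightarrow> bool" where
  "is_species p \<longleftrightarrow>
     (\<forall>I. finite I \<longrightarrow> is_vsp (val p I) \<and> finite_dim_vsp (val p I)) \<and>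
     (\<forall>I \<sigma>. finite I \<and> inj_on \<sigma> I \<longrightarrow> linear_map (val p I) (val p (\<sigma> ` I)) (relabel p I \<sigma>)) \<and>
     (\<forall>I \<sigma> \<tau>. finite I \<and> inj_on \<sigma> I \<and> (\<forall>i\<in>I. \<sigma> i = \<tau> i) \<longrightarrow>
        (\<forall>x\<in>obj p I. relabel p I \<sigma> x = relabel p I \<tau> x)) \<and>
     (\<forall>I. finite I \<longrightarrow> (\<forall>x\<in>obj p I. relabel p I id x = x)) \<and>
     (\<forall>I \<sigma> \<tau>. finite I \<and> inj_on \<sigma> I \<and> inj_on \<tau> (\<sigma> ` I) \<longrightarrow>
        (\<forall>x\<in>obj p I. relabel p I (\<tau> \<circ> \<sigma>) x = relabel p (\<sigma> ` I) \<tau> (relabel p I \<sigma> x)))"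

definition species_morphism ::
    "('a::infinite, 'f::field_char_0, 'v::ab_group_add, 'y) species_scheme \<Rightarrow>
     ('a, 'f, 'w::ab_group_add, 'z) species_scheme \<Rightarrow> ('a set \<Rightarrow> 'v \<Rightarrow> 'w) \<Rightarrow> bool" where
  "species_morphism p q f \<longleftrightarrow>
     (\<forall>I. finite I \<longrightarrow> linear_map (val p I) (val q I) (f I)) \<and>
     (\<forall>I \<sigma>. finite I \<and> inj_on \<sigma> I \<longrightarrow>
        (\<forall>x\<in>obj p I. f (\<sigma> ` I) (relabel p I \<sigma> x) = relabel q I \<sigma> (f I x)))"

definition species_isomorphism ::
    "('a::infinite, 'f::field_char_0, 'v::ab_group_add, 'y) species_scheme \<Rightarrow>
     ('a, 'f, 'w::ab_group_add, 'z) species_scheme \<Rightarrow> ('a set \<Rightarrow> 'v \<Rightarrow> 'w) \<Rightarrow> bool" where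
  "species_isomorphism p q f \<longleftrightarrow>
     species_morphism p q f \<and> (\<forall>I. finite I \<longrightarrow> bij_betw (f I) (obj p I) (obj q I))"

definition species_isomorphic ::
    "('a::infinite, 'f::field_char_0, 'v::ab_group_add, 'y) species_scheme \<Rightarrow>
     ('a, 'f, 'w::ab_group_add, 'z) species_scheme \<Rightarrow> bool" where
  "species_isomorphic p q \<longleftrightarrow> is_species p \<and> is_species q \<and> (\<exists>f. species_isomorphism p q f)"

definition connected_species :: "('a::infinite, 'f::field_char_0, 'v::ab_group_add, 'z) species_scheme \<Rightarrow> bool" where
  "connected_species p \<longleftrightarrow> vector_space.dim (scl p) (obj p {}) = 1"

definition positive_part :: "('a, 'f, 'v::ab_group_add, 'z) species_scheme \<Rightarrow> ('a, 'f, 'v) species" where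
  "positive_part p =
     \<lparr>scl = scl p, obj = (\<lambda>I. if I = {} then {0} else obj p I), relabel = relabel p\<rparr>"

text \<open>The canonical projection \<open>p \<rightarrow> p\<^sub>+\<close>.\<close>

definition positive_proj :: "'a set \<Rightarrow> 'v::ab_group_add \<Rightarrow> 'v" where
  "positive_proj I x = (if I = {} then 0 else x)"


section \<open>The symmetric monoidal category of species\<close>

text \<open>
  An element of \<open>(p \<cdot> q)[I]\<close> is a family indexed by sets \<open>S\<close>, whose member at \<open>S \<subseteq> I\<close> is the
  component in \<open>p[S] \<otimes> q[I - S]\<close>, and which vanishes at all other \<open>S\<close>.
\<close>

type_synonym ('a, 'f, 'v, 'w) cauchy = "'a set \<Rightarrow> ('f, 'v, 'w) tensor"

definition cauchy_map ::
    "('a, 'f::field, 'v'::ab_group_add, 'y) species_scheme \<Rightarrow> ('a, 'f, 'w'::ab_group_add, 'z) species_scheme \<Rightarrow>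
     ('a set \<Rightarrow> 'v \<Rightarrow> 'v') \<Rightarrow> ('a set \<Rightarrow> 'w \<Rightarrow> 'w') \<Rightarrow>
     'a set \<Rightarrow> ('a, 'f, 'v, 'w) cauchy \<Rightarrow> ('a, 'f, 'v', 'w') cauchy" where
  "cauchy_map p' q' f g I t =
     (\<lambda>S. if S \<subseteq> I then tensor_map (val p' S) (val q' (I - S)) (f S) (g (I - S)) (t S) else 0)"

definition cauchy ::
    "('a, 'f::field, 'v::ab_group_add, 'y) species_scheme \<Rightarrow> ('a, 'f, 'w::ab_group_add, 'z) species_scheme \<Rightarrow>
     ('a, 'f, ('a, 'f, 'v, 'w) cauchy) species" where
  "cauchy p q =
     \<lparr>scl = (\<lambda>c t S. tensor_scale c (t S)),
      obj = (\<lambda>I. {t. \<forall>S. if S \<subseteq> I then t S \<in> snd (tensor_product (val p S) (val q (I - S))) else t S = 0}),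
      relabel = (\<lambda>I \<sigma> t S'.
        if S' \<subseteq> \<sigma> ` I
        then let S = {i \<in> I. \<sigma> i \<in> S'}
             in tensor_map (val p S') (val q (\<sigma> ` I - S')) (relabel p S \<sigma>) (relabel q (I - S) \<sigma>) (t S)
        else 0)\<rparr>"

text \<open>The inclusion of the summand \<open>p[S] \<otimes> q[I - S]\<close>, and \<open>x \<otimes> y\<close> as an element of \<open>(p \<cdot> q)[S \<squnion> T]\<close>.\<close>

definition summand :: "'a set \<Rightarrow> ('f::field, 'v, 'w) tensor \<Rightarrow> ('a, 'f, 'v, 'w) cauchy" where
  "summand S u = (\<lambda>S'. if S' = S then u else 0)"

definition pure_cauchy ::
    "('a, 'f::field, 'v::ab_group_add, 'y) species_scheme \<Rightarrow> ('a, 'f, 'w::ab_group_add, 'z) species_scheme \<Rightarrow>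
     'a set \<Rightarrow> 'a set \<Rightarrow> 'v \<Rightarrow> 'w \<Rightarrow> ('a, 'f, 'v, 'w) cauchy" where
  "pure_cauchy p q S T x y = summand S (pure_tensor (val p S) (val q T) x y)"

definition unit_species :: "('a, 'f::field, 'f) species" where
  "unit_species = \<lparr>scl = (*), obj = (\<lambda>I. if I = {} then UNIV else {0}), relabel = (\<lambda>I \<sigma> x. x)\<rparr>"

text \<open>The unit isomorphisms \<open>p \<rightarrow> 1 \<cdot> p\<close> and \<open>p \<rightarrow> p \<cdot> 1\<close>.\<close>

definition unit_left ::
    "('a, 'f::field, 'v::ab_group_add, 'z) species_scheme \<Rightarrow> 'a set \<Rightarrow> 'v \<Rightarrow> ('a, 'f, 'f, 'v) cauchy" where
  "unit_left p I x = pure_cauchy unit_species p {} I 1 x"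

definition unit_right ::
    "('a, 'f::field, 'v::ab_group_add, 'z) species_scheme \<Rightarrow> 'a set \<Rightarrow> 'v \<Rightarrow> ('a, 'f, 'v, 'f) cauchy" where
  "unit_right p I x = pure_cauchy p unit_species I {} x 1"

text \<open>
  The associativity isomorphism \<open>(p \<cdot> q) \<cdot> r \<rightarrow> p \<cdot> (q \<cdot> r)\<close>, \<open>(x \<otimes> y) \<otimes> z \<mapsto> x \<otimes> (y \<otimes> z)\<close>
  (lemma \<open>cauchy_assoc_pure\<close>), written out on functionals on bilinear forms.
\<close>

definition cauchy_assoc ::
    "('a, 'f::field, 'u::ab_group_add, 'x) species_scheme \<Rightarrow> ('a, 'f, 'v::ab_group_add, 'y) species_scheme \<Rightarrow>
     ('a, 'f, 'w::ab_group_add, 'z) species_scheme \<Rightarrow>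
     'a set \<Rightarrow> ('a, 'f, ('a, 'f, 'u, 'v) cauchy, 'w) cauchy \<Rightarrow> ('a, 'f, 'u, ('a, 'f, 'v, 'w) cauchy) cauchy" where
  "cauchy_assoc p q r I t =
     (\<lambda>S B. if S \<subseteq> I \<and> bilinear_form (val p S) (val (cauchy q r) (I - S)) B
            then \<Sum>U | S \<subseteq> U \<and> U \<subseteq> I.
                   t U (\<lambda>u z. u S (\<lambda>x y. B x (pure_cauchy q r (U - S) (I - U) y z)))
            else 0)"

text \<open>
  The isomorphism \<open>id \<cdot> \<beta> \<cdot> id : (p \<cdot> q) \<cdot> (r \<cdot> s) \<rightarrow> (p \<cdot> r) \<cdot> (q \<cdot> s)\<close> given by the braiding
  \<open>\<beta>(x \<otimes> y) = y \<otimes> x\<close>, i.e. \<open>(x \<otimes> y) \<otimes> (x' \<otimes> y') \<mapsto> (x \<otimes> x') \<otimes> (y \<otimes> y')\<close>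
  (lemma \<open>cauchy_interchange_pure\<close>).
\<close>

definition cauchy_interchange ::
    "('a, 'f::field, 'v1::ab_group_add, 'z1) species_scheme \<Rightarrow> ('a, 'f, 'v2::ab_group_add, 'z2) species_scheme \<Rightarrow>
     ('a, 'f, 'v3::ab_group_add, 'z3) species_scheme \<Rightarrow> ('a, 'f, 'v4::ab_group_add, 'z4) species_scheme \<Rightarrow>
     'a set \<Rightarrow> ('a, 'f, ('a, 'f, 'v1, 'v2) cauchy, ('a, 'f, 'v3, 'v4) cauchy) cauchy \<Rightarrow>
     ('a, 'f, ('a, 'f, 'v1, 'v3) cauchy, ('a, 'f, 'v2, 'v4) cauchy) cauchy" where
  "cauchy_interchange p q r s I t =
     (\<lambda>S' B. if S' \<subseteq> I \<and> bilinear_form (val (cauchy p r) S') (val (cauchy q s) (I - S')) B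
             then \<Sum>S | S \<subseteq> I.
                    t S (\<lambda>u w. u (S \<inter> S') (\<lambda>x y. w (S' - S) (\<lambda>x' y'.
                      B (pure_cauchy p r (S \<inter> S') (S' - S) x x')
                        (pure_cauchy q s (S - S') (I - S - S') y y'))))
             else 0)"


section \<open>Hopf monoids\<close>

record ('a, 'f, 'v) hopf = "('a, 'f, 'v) species" +
  mul :: "'a set \<Rightarrow> ('a, 'f, 'v, 'v) cauchy \<Rightarrow> 'v"
  unt :: "'a set \<Rightarrow> 'f \<Rightarrow> 'v"
  comul :: "'a set \<Rightarrow> 'v \<Rightarrow> ('a, 'f, 'v, 'v) cauchy"
  counit :: "'a set \<Rightarrow> 'v \<Rightarrow> 'f"

abbreviation idm :: "'a set \<Rightarrow> 'v \<Rightarrow> 'v" where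
  "idm \<equiv> \<lambda>I x. x"

definition is_monoid :: "('a::infinite, 'f::field_char_0, 'v::ab_group_add, 'z) hopf_scheme \<Rightarrow> bool" where
  "is_monoid h \<longleftrightarrow>
     is_species h \<and>
     species_morphism (cauchy h h) h (mul h) \<and>
     species_morphism unit_species h (unt h) \<and>
     (\<forall>I. finite I \<longrightarrow>
        (\<forall>t\<in>obj (cauchy (cauchy h h) h) I.
           mul h I (cauchy_map h h (mul h) idm I t) =
           mul h I (cauchy_map h h idm (mul h) I (cauchy_assoc h h h I t))) \<and>
        (\<forall>x\<in>obj h I. mul h I (cauchy_map h h (unt h) idm I (unit_left h I x)) = x) \<and>
        (\<forall>x\<in>obj h I. mul h I (cauchy_map h h idm (unt h) I (unit_right h I x)) = x))"

definition is_comonoid :: "('a::infinite, 'f::field_char_0, 'v::ab_group_add, 'z) hopf_scheme \<Rightarrow> bool" where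
  "is_comonoid h \<longleftrightarrow>
     is_species h \<and>
     species_morphism h (cauchy h h) (comul h) \<and>
     species_morphism h unit_species (counit h) \<and>
     (\<forall>I. finite I \<longrightarrow>
        (\<forall>x\<in>obj h I.
           cauchy_assoc h h h I (cauchy_map (cauchy h h) h (comul h) idm I (comul h I x)) =
           cauchy_map h (cauchy h h) idm (comul h) I (comul h I x)) \<and>
        (\<forall>x\<in>obj h I. cauchy_map unit_species h (counit h) idm I (comul h I x) = unit_left h I x) \<and>
        (\<forall>x\<in>obj h I. cauchy_map h unit_species idm (counit h) I (comul h I x) = unit_right h I x))"

definition is_bimonoid :: "('a::infinite, 'f::field_char_0, 'v::ab_group_add, 'z) hopf_scheme \<Rightarrow> bool" where
  "is_bimonoid h \<longleftrightarrow>
     is_monoid h \<and> is_comonoid h \<and>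
     (\<forall>I. finite I \<longrightarrow>
        (\<forall>t\<in>obj (cauchy h h) I.
           comul h I (mul h I t) =
           cauchy_map h h (mul h) (mul h) I
             (cauchy_interchange h h h h I
               (cauchy_map (cauchy h h) (cauchy h h) (comul h) (comul h) I t))) \<and>
        (\<forall>c\<in>obj unit_species I.
           comul h I (unt h I c) = cauchy_map h h (unt h) (unt h) I (unit_left unit_species I c)) \<and>
        (\<forall>t\<in>obj (cauchy h h) I.
           unit_left unit_species I (counit h I (mul h I t)) =
           cauchy_map unit_species unit_species (counit h) (counit h) I t) \<and>
        (\<forall>c\<in>obj unit_species I. counit h I (unt h I c) = c))"

definition is_antipode ::
    "('a::infinite, 'f::field_char_0, 'v::ab_group_add, 'z) hopf_scheme \<Rightarrow> ('a set \<Rightarrow> 'v \<Rightarrow> 'v) \<Rightarrow> bool" where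
  "is_antipode h s \<longleftrightarrow>
     species_morphism h h s \<and>
     (\<forall>I. finite I \<longrightarrow> (\<forall>x\<in>obj h I.
        mul h I (cauchy_map h h s idm I (comul h I x)) = unt h I (counit h I x) \<and>
        mul h I (cauchy_map h h idm s I (comul h I x)) = unt h I (counit h I x)))"

definition is_hopf_monoid :: "('a::infinite, 'f::field_char_0, 'v::ab_group_add, 'z) hopf_scheme \<Rightarrow> bool" where
  "is_hopf_monoid h \<longleftrightarrow> is_bimonoid h \<and> (\<exists>s. is_antipode h s)"

text \<open>Compatibility with the antipodes is automatic.\<close>

definition hopf_morphism ::
    "('a::infinite, 'f::field_char_0, 'v::ab_group_add, 'y) hopf_scheme \<Rightarrow>
     ('a, 'f, 'w::ab_group_add, 'z) hopf_scheme \<Rightarrow> ('a set \<Rightarrow> 'v \<Rightarrow> 'w) \<Rightarrow> bool" where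
  "hopf_morphism h k f \<longleftrightarrow>
     species_morphism h k f \<and>
     (\<forall>I. finite I \<longrightarrow>
        (\<forall>t\<in>obj (cauchy h h) I. f I (mul h I t) = mul k I (cauchy_map k k f f I t)) \<and>
        (\<forall>c\<in>obj unit_species I. f I (unt h I c) = unt k I c) \<and>
        (\<forall>x\<in>obj h I. comul k I (f I x) = cauchy_map k k f f I (comul h I x)) \<and>
        (\<forall>x\<in>obj h I. counit k I (f I x) = counit h I x))"

definition surjective_morphism ::
    "('a, 'f, 'v, 'y) species_scheme \<Rightarrow> ('a, 'f, 'w, 'z) species_scheme \<Rightarrow> ('a set \<Rightarrow> 'v \<Rightarrow> 'w) \<Rightarrow> bool" where
  "surjective_morphism p q f \<longleftrightarrow> (\<forall>I. finite I \<longrightarrow> f I ` obj p I = obj q I)"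

definition Hker ::
    "('a, 'f::field, 'v::ab_group_add, 'y) hopf_scheme \<Rightarrow> ('a, 'f, 'w::ab_group_add, 'z) hopf_scheme \<Rightarrow>
     ('a set \<Rightarrow> 'v \<Rightarrow> 'w) \<Rightarrow> ('a, 'f, 'v) species" where
  "Hker h k \<pi> =
     \<lparr>scl = scl h,
      obj = (\<lambda>I. {x \<in> obj h I.
        cauchy_map (positive_part k) h (\<lambda>S y. positive_proj S (\<pi> S y)) idm I (comul h I x) = 0}),
      relabel = relabel h\<rparr>"


section \<open>Comodules\<close>

definition left_comodule ::
    "('a::infinite, 'f::field_char_0, 'w::ab_group_add, 'y) hopf_scheme \<Rightarrow>
     ('a, 'f, 'v::ab_group_add, 'z) species_scheme \<Rightarrow> ('a set \<Rightarrow> 'v \<Rightarrow> ('a, 'f, 'w, 'v) cauchy) \<Rightarrow> bool" where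
  "left_comodule k m \<delta> \<longleftrightarrow>
     is_species m \<and>
     species_morphism m (cauchy k m) \<delta> \<and>
     (\<forall>I. finite I \<longrightarrow>
        (\<forall>x\<in>obj m I.
           cauchy_assoc k k m I (cauchy_map (cauchy k k) m (comul k) idm I (\<delta> I x)) =
           cauchy_map k (cauchy k m) idm \<delta> I (\<delta> I x)) \<and>
        (\<forall>x\<in>obj m I. cauchy_map unit_species m (counit k) idm I (\<delta> I x) = unit_left m I x))"

definition left_comodule_isomorphic ::
    "('a::infinite, 'f::field_char_0, 'u::ab_group_add, 'x) hopf_scheme \<Rightarrow>
     ('a, 'f, 'v::ab_group_add, 'y) species_scheme \<Rightarrow> ('a set \<Rightarrow> 'v \<Rightarrow> ('a, 'f, 'u, 'v) cauchy) \<Rightarrow>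
     ('a, 'f, 'w::ab_group_add, 'z) species_scheme \<Rightarrow> ('a set \<Rightarrow> 'w \<Rightarrow> ('a, 'f, 'u, 'w) cauchy) \<Rightarrow> bool" where
  "left_comodule_isomorphic k m \<delta> n \<eta> \<longleftrightarrow>
     left_comodule k m \<delta> \<and> left_comodule k n \<eta> \<and>
     (\<exists>f. species_isomorphism m n f \<and>
        (\<forall>I. finite I \<longrightarrow> (\<forall>x\<in>obj m I. \<eta> I (f I x) = cauchy_map k n idm f I (\<delta> I x))))"

text \<open>The coaction \<open>(\<pi> \<cdot> id) \<circ> \<Delta> : h \<rightarrow> k \<cdot> h\<close> induced by \<open>\<pi> : h \<rightarrow> k\<close>.\<close>

definition induced_coaction ::
    "('a, 'f::field, 'v::ab_group_add, 'y) hopf_scheme \<Rightarrow> ('a, 'f, 'w::ab_group_add, 'z) hopf_scheme \<Rightarrow>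
     ('a set \<Rightarrow> 'v \<Rightarrow> 'w) \<Rightarrow> 'a set \<Rightarrow> 'v \<Rightarrow> ('a, 'f, 'w, 'v) cauchy" where
  "induced_coaction h k \<pi> I x = cauchy_map k h \<pi> idm I (comul h I x)"

text \<open>The coaction \<open>\<Delta> \<cdot> id : k \<cdot> q \<rightarrow> k \<cdot> (k \<cdot> q)\<close> of the cofree comodule on \<open>q\<close>.\<close>

definition cofree_coaction ::
    "('a, 'f::field, 'w::ab_group_add, 'y) hopf_scheme \<Rightarrow> ('a, 'f, 'v::ab_group_add, 'z) species_scheme \<Rightarrow>
     'a set \<Rightarrow> ('a, 'f, 'w, 'v) cauchy \<Rightarrow> ('a, 'f, 'w, ('a, 'f, 'w, 'v) cauchy) cauchy" where
  "cofree_coaction k q I t = cauchy_assoc k k q I (cauchy_map (cauchy k k) q (comul k) idm I t)"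

text \<open>
  Taking \<open>q\<close> over the same type \<open>'v\<close> as \<open>m\<close> is harmless: \<open>q[I] \<cong> k[\<emptyset>] \<otimes> q[I]\<close> for connected
  \<open>k\<close>, so \<open>q[I]\<close> embeds into \<open>(k \<cdot> q)[I] \<cong> m[I]\<close>.
\<close>

definition cofree_left_comodule ::
    "('a::infinite, 'f::field_char_0, 'w::ab_group_add, 'y) hopf_scheme \<Rightarrow>
     ('a, 'f, 'v::ab_group_add, 'z) species_scheme \<Rightarrow> ('a set \<Rightarrow> 'v \<Rightarrow> ('a, 'f, 'w, 'v) cauchy) \<Rightarrow> bool" where
  "cofree_left_comodule k m \<delta> \<longleftrightarrow>
     (\<exists>q :: ('a, 'f, 'v) species. is_species q \<and>
        left_comodule_isomorphic k m \<delta> (cauchy k q) (cofree_coaction k q))"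


section \<open>Characterisation of the tensor product and of the structure isomorphisms\<close>

lemma vector_space_tensor_scale: "vector_space tensor_scale"
  by unfold_locales (auto simp: tensor_scale_def fun_eq_iff algebra_simps)

lemma tensor_induct [consumes 1, case_names zero add scale pure]:
  assumes "t \<in> snd (tensor_product V W)"
    and "P 0"
    and "\<And>t u. P t \<Longrightarrow> P u \<Longrightarrow> P (t + u)"
    and "\<And>c t. P t \<Longrightarrow> P (tensor_scale c t)"
    and "\<And>x y. x \<in> snd V \<Longrightarrow> y \<in> snd W \<Longrightarrow> P (pure_tensor V W x y)"
  shows "P t"
proof -
  interpret vector_space tensor_scale by (rule vector_space_tensor_scale)
  from assms(1) have "t \<in> span {pure_tensor V W x y | x y. x \<in> snd V \<and> y \<in> snd W}"
    by (simp add: tensor_product_def)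
  then show ?thesis
  proof (induction rule: span_induct_alt)
    case base
    show ?case by (rule assms(2))
  next
    case (step c x y)
    then obtain a b where "x = pure_tensor V W a b" "a \<in> snd V" "b \<in> snd W" by blast
    with step assms(5) show ?case by (intro assms(3,4)) auto
  qed
qed

lemma is_vsp_tensor_product: "is_vsp (tensor_product V W)"
proof -
  interpret vector_space tensor_scale by (rule vector_space_tensor_scale)
  show ?thesis by (simp add: is_vsp_def tensor_product_def vector_space_tensor_scale subspace_span)
qed

lemma pure_tensor_in: "x \<in> snd V \<Longrightarrow> y \<in> snd W \<Longrightarrow> pure_tensor V W x y \<in> snd (tensor_product V W)"
  unfolding tensor_product_def snd_conv
  by (rule module.span_base[OF vector_space_tensor_scale[unfolded module_iff_vector_space[symmetric]]]) auto

lemma is_vsp_closed: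
  assumes "is_vsp V"
  shows "0 \<in> snd V"
    and "\<And>x y. x \<in> snd V \<Longrightarrow> y \<in> snd V \<Longrightarrow> x + y \<in> snd V"
    and "\<And>c x. x \<in> snd V \<Longrightarrow> fst V c x \<in> snd V"
  using assms module.subspace_0 module.subspace_add module.subspace_scale
  by (auto simp: is_vsp_def module_iff_vector_space[symmetric])

lemma linear_map_0: "is_vsp V \<Longrightarrow> linear_map V W f \<Longrightarrow> f 0 = 0"
  unfolding linear_map_def by (metis add.right_neutral add_left_cancel is_vsp_closed(1))

lemma bilinear_map_cong:
  assumes "is_vsp V" "is_vsp W" "\<And>x y. x \<in> snd V \<Longrightarrow> y \<in> snd W \<Longrightarrow> b x y = b' x y"
  shows "bilinear_map V W U b \<longleftrightarrow> bilinear_map V W U b'"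
  unfolding bilinear_map_def linear_map_def
  using assms(3) is_vsp_closed[OF assms(1)] is_vsp_closed[OF assms(2)] by (simp cong: ball_cong)

lemma bilinear_mapD:
  assumes "bilinear_map V W U b"
  shows "\<And>x y. x \<in> snd V \<Longrightarrow> y \<in> snd W \<Longrightarrow> b x y \<in> snd U"
    and "\<And>x x' y. x \<in> snd V \<Longrightarrow> x' \<in> snd V \<Longrightarrow> y \<in> snd W \<Longrightarrow> b (x + x') y = b x y + b x' y"
    and "\<And>x y y'. x \<in> snd V \<Longrightarrow> y \<in> snd W \<Longrightarrow> y' \<in> snd W \<Longrightarrow> b x (y + y') = b x y + b x y'"
    and "\<And>c x y. x \<in> snd V \<Longrightarrow> y \<in> snd W \<Longrightarrow> b (fst V c x) y = fst U c (b x y)"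
    and "\<And>c x y. x \<in> snd V \<Longrightarrow> y \<in> snd W \<Longrightarrow> b x (fst W c y) = fst U c (b x y)"
  using assms unfolding bilinear_map_def linear_map_def by blast+

lemma bilinear_mapI:
  assumes "\<And>x y. x \<in> snd V \<Longrightarrow> y \<in> snd W \<Longrightarrow> b x y \<in> snd U"
    and "\<And>x x' y. x \<in> snd V \<Longrightarrow> x' \<in> snd V \<Longrightarrow> y \<in> snd W \<Longrightarrow> b (x + x') y = b x y + b x' y"
    and "\<And>x y y'. x \<in> snd V \<Longrightarrow> y \<in> snd W \<Longrightarrow> y' \<in> snd W \<Longrightarrow> b x (y + y') = b x y + b x y'"
    and "\<And>c x y. x \<in> snd V \<Longrightarrow> y \<in> snd W \<Longrightarrow> b (fst V c x) y = fst U c (b x y)"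
    and "\<And>c x y. x \<in> snd V \<Longrightarrow> y \<in> snd W \<Longrightarrow> b x (fst W c y) = fst U c (b x y)"
  shows "bilinear_map V W U b"
  using assms unfolding bilinear_map_def linear_map_def by blast

lemma bilinear_form_add:
  "bilinear_form V W B \<Longrightarrow> bilinear_form V W B' \<Longrightarrow> bilinear_form V W (\<lambda>x y. B x y + B' x y)"
  unfolding bilinear_map_def linear_map_def by (auto simp: algebra_simps)

lemma bilinear_form_scale: "bilinear_form V W B \<Longrightarrow> bilinear_form V W (\<lambda>x y. c * B x y)"
  unfolding bilinear_map_def linear_map_def by (auto simp: algebra_simps)

lemma bilinear_map_pure_tensor:
  "bilinear_map V W (tensor_product V W) (pure_tensor V W)"
  by (rule bilinear_mapI)
    (auto simp: pure_tensor_in, auto simp: fun_eq_iff pure_tensor_def tensor_product_def tensor_scale_def bilinear_mapD)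

lemma tensor_apply_add:
  assumes "t \<in> snd (tensor_product V W)" "bilinear_form V W B" "bilinear_form V W B'"
  shows "t (\<lambda>x y. B x y + B' x y) = t B + t B'"
  using assms(1)
  by (induction rule: tensor_induct)
    (auto simp: pure_tensor_def tensor_scale_def bilinear_form_add assms algebra_simps)

lemma tensor_apply_scale:
  assumes "t \<in> snd (tensor_product V W)" "bilinear_form V W B"
  shows "t (\<lambda>x y. c * B x y) = c * t B"
  using assms(1)
  by (induction rule: tensor_induct)
    (auto simp: pure_tensor_def tensor_scale_def bilinear_form_scale assms algebra_simps)

lemma tensor_apply_cong:
  assumes "is_vsp V" "is_vsp W" "t \<in> snd (tensor_product V W)"
    and "\<And>x y. x \<in> snd V \<Longrightarrow> y \<in> snd W \<Longrightarrow> B x y = B' x y"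
  shows "t B = t B'"
  using assms(3)
proof (induction rule: tensor_induct)
  case (pure x y)
  then show ?case using bilinear_map_cong[OF assms(1,2,4)] assms(4) by (simp add: pure_tensor_def)
qed (auto simp: tensor_scale_def)

lemma functional_separates:
  fixes s :: "'f::field \<Rightarrow> 'u::ab_group_add \<Rightarrow> 'u"
  assumes "vector_space s" "\<And>l. Vector_Spaces.linear s (*) l \<Longrightarrow> l u = l v"
  shows "u = v"
proof (rule ccontr)
  interpret vector_space_pair s "(*) :: 'f \<Rightarrow> 'f \<Rightarrow> 'f"
    using assms(1) by (simp add: vector_space_pair_def) (unfold_locales, simp_all add: algebra_simps)
  assume "u \<noteq> v"
  then have i: "vs1.independent {u - v}" by (simp add: vs1.dependent_single)
  define l where "l = construct {u - v} (\<lambda>_. 1 :: 'f)"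
  have l: "Vector_Spaces.linear s (*) l" unfolding l_def by (rule linear_construct[OF i])
  have "l (u - v) = 1" unfolding l_def by (rule construct_basis[OF i]) simp
  moreover have "l (u - v) = l u - l v"
    using l by (simp add: linear_diff)
  ultimately show False using assms(2)[OF l] by simp
qed

lemma tensor_universal:
  assumes "is_vsp U" "bilinear_map V W U b"
  shows "\<exists>f. linear_map (tensor_product V W) U f \<and>
             (\<forall>x\<in>snd V. \<forall>y\<in>snd W. f (pure_tensor V W x y) = b x y)"
    and "\<And>f g. linear_map (tensor_product V W) U f \<Longrightarrow> linear_map (tensor_product V W) U g \<Longrightarrow>
           (\<forall>x\<in>snd V. \<forall>y\<in>snd W. f (pure_tensor V W x y) = g (pure_tensor V W x y)) \<Longrightarrow>
           (\<forall>t\<in>snd (tensor_product V W). f t = g t)"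
proof -
  interpret vector_space "fst U" using assms(1) by (simp add: is_vsp_def)
  define R where "R t u \<longleftrightarrow> u \<in> snd U \<and>
    (\<forall>l. Vector_Spaces.linear (fst U) (*) l \<longrightarrow> l u = t (\<lambda>x y. l (b x y)))" for t u
  note U = is_vsp_closed[OF assms(1)]
  have uniq: "u = v" if "R t u" "R t v" for t u v
    using that functional_separates[OF vector_space_axioms] by (metis R_def)
  have lin: "l (x + y) = l x + l y" "l (fst U c x) = c * l x" "l 0 = 0"
    if "Vector_Spaces.linear (fst U) (*) l" for l and x y c
    using that by (auto simp: linear_iff_module_hom module_hom.add module_hom.scale module_hom.zero)
  have R0: "R 0 0" by (simp add: R_def U lin)
  have Radd: "R (t + t') (u + u')" if "R t u" "R t' u'" for t t' u u'
    using that by (simp add: R_def U lin)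
  have Rscale: "R (tensor_scale c t) (fst U c u)" if "R t u" for c t u
    using that by (simp add: R_def U lin tensor_scale_def)
  have Rpure: "R (pure_tensor V W x y) (b x y)" if "x \<in> snd V" "y \<in> snd W" for x y
  proof -
    have "bilinear_form V W (\<lambda>x y. l (b x y))" if "Vector_Spaces.linear (fst U) (*) l" for l
      by (rule bilinear_mapI) (simp_all add: bilinear_mapD[OF assms(2)] lin[OF that])
    then show ?thesis using that bilinear_mapD(1)[OF assms(2)] by (simp add: R_def pure_tensor_def)
  qed
  define f where "f t = (THE u. R t u)" for t
  have fI: "f t = u" if "R t u" for t u
    unfolding f_def using that uniq by blast
  have Rf: "R t (f t)" if "t \<in> snd (tensor_product V W)" for t
  proof -
    from that have "\<exists>u. R t u"
      by (induction rule: tensor_induct) (blast intro: R0 Radd Rscale Rpure)+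
    then show ?thesis using fI by blast
  qed
  have "linear_map (tensor_product V W) U f"
    unfolding linear_map_def
  proof (intro conjI ballI allI)
    show "f (t + u) = f t + f u" if "t \<in> snd (tensor_product V W)" "u \<in> snd (tensor_product V W)" for t u
      using that by (intro fI Radd Rf)
    show "f (fst (tensor_product V W) c t) = fst U c (f t)" if "t \<in> snd (tensor_product V W)" for c t
      using fI[OF Rscale[OF Rf[OF that]]] by (simp add: tensor_product_def)
  qed (use Rf R_def in blast)
  then show "\<exists>f. linear_map (tensor_product V W) U f \<and>
             (\<forall>x\<in>snd V. \<forall>y\<in>snd W. f (pure_tensor V W x y) = b x y)"
    using fI Rpure by blast
next
  fix f g
  assume f: "linear_map (tensor_product V W) U f" and g: "linear_map (tensor_product V W) U g"
    and eq: "\<forall>x\<in>snd V. \<forall>y\<in>snd W. f (pure_tensor V W x y) = g (pure_tensor V W x y)"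
  show "\<forall>t\<in>snd (tensor_product V W). f t = g t"
  proof
    fix t assume "t \<in> snd (tensor_product V W)"
    then have "t \<in> snd (tensor_product V W) \<and> f t = g t"
    proof (induction rule: tensor_induct)
      case zero
      show ?case using linear_map_0[OF is_vsp_tensor_product] f g is_vsp_closed[OF is_vsp_tensor_product] by metis
    next
      case (add t u)
      then show ?case using f g is_vsp_closed[OF is_vsp_tensor_product] unfolding linear_map_def by metis
    next
      case (scale c t)
      have "tensor_scale = fst (tensor_product V W)" by (simp add: tensor_product_def)
      with scale show ?case using f g is_vsp_closed[OF is_vsp_tensor_product] unfolding linear_map_def by metis
    next
      case (pure x y)
      then show ?case using eq pure_tensor_in by blast
    qed
    then show "f t = g t" ..
  qed
qed

lemma tensor_map_pure:
  assumes "linear_map V V' f" "linear_map W W' g" "x \<in> snd V" "y \<in> snd W"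
  shows "tensor_map V' W' f g (pure_tensor V W x y) = pure_tensor V' W' (f x) (g y)"
proof
  fix B
  have "bilinear_form V W (\<lambda>x y. B (f x) (g y))" if "bilinear_form V' W' B"
    by (rule bilinear_mapI) (use assms(1,2) in \<open>simp_all add: linear_map_def bilinear_mapD[OF that]\<close>)
  then show "tensor_map V' W' f g (pure_tensor V W x y) B = pure_tensor V' W' (f x) (g y) B"
    by (simp add: tensor_map_def pure_tensor_def)
qed

lemma cauchy_component:
  "t \<in> obj (cauchy p q) I \<Longrightarrow> S \<subseteq> I \<Longrightarrow> t S \<in> snd (tensor_product (val p S) (val q (I - S)))"
  by (auto simp: cauchy_def split: if_splits)

lemma bilinear_map_pure_cauchy:
  assumes "S \<inter> T = {}" "I = S \<union> T"
  shows "bilinear_map (val p S) (val q T) (val (cauchy p q) I) (pure_cauchy p q S T)"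
proof -
  have IS: "I - S = T" and SI: "S \<subseteq> I" using assms by blast+
  note b = bilinear_mapD[OF bilinear_map_pure_tensor[of "val p S" "val q T"], unfolded tensor_product_def fst_conv]
  have [simp]: "0 \<in> snd (tensor_product (val p X) (val q Y))" for X Y
    by (rule is_vsp_closed(1)[OF is_vsp_tensor_product])
  show ?thesis
    by (rule bilinear_mapI)
      (use SI in \<open>auto simp: IS pure_cauchy_def cauchy_def summand_def pure_tensor_in fun_eq_iff b[unfolded snd_conv]
        tensor_scale_def\<close>)
qed

lemma cauchy_assoc_pure:
  assumes fin: "finite S" "finite T" "finite R"
    and disj: "S \<inter> T = {}" "S \<inter> R = {}" "T \<inter> R = {}"
    and vsp: "is_vsp (val p S)" "is_vsp (val q T)"
    and x: "x \<in> obj p S" and y: "y \<in> obj q T" and z: "z \<in> obj r R"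
  shows "cauchy_assoc p q r (S \<union> T \<union> R)
           (pure_cauchy (cauchy p q) r (S \<union> T) R (pure_cauchy p q S T x y) z) =
         pure_cauchy p (cauchy q r) S (T \<union> R) x (pure_cauchy q r T R y z)" (is "?l = ?r")
proof (intro ext)
  fix S' and B :: "'c \<Rightarrow> ('a, 'b, 'e, 'g) cauchy \<Rightarrow> 'b"
  let ?I = "S \<union> T \<union> R"
  let ?t = "pure_cauchy (cauchy p q) r (S \<union> T) R (pure_cauchy p q S T x y) z"
  let ?F = "\<lambda>U u z. u S' (\<lambda>x y. B x (pure_cauchy q r (U - S') (?I - U) y z))"
  have *: "?l S' B = ?t (S \<union> T) (?F (S \<union> T))"
    if "S' \<subseteq> S \<union> T" "bilinear_form (val p S') (val (cauchy q r) (?I - S')) B"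
  proof -
    have "?l S' B = (\<Sum>U | S' \<subseteq> U \<and> U \<subseteq> ?I. ?t U (?F U))"
      using that by (auto simp: cauchy_assoc_def)
    also have "\<dots> = (\<Sum>U | S' \<subseteq> U \<and> U \<subseteq> ?I. if U = S \<union> T then ?t (S \<union> T) (?F (S \<union> T)) else 0)"
      by (rule sum.cong) (auto simp: pure_cauchy_def[of "cauchy p q"] summand_def)
    also have "\<dots> = ?t (S \<union> T) (?F (S \<union> T))"
      using that fin by (subst sum.delta) auto
    finally show ?thesis .
  qed
  have **: "?l S' B = 0" if "\<not> S' \<subseteq> S \<union> T"
    using that by (auto simp: cauchy_assoc_def pure_cauchy_def[of "cauchy p q"] summand_def intro!: sum.neutral)
  have dT: "S \<union> T - S = T" and dR: "?I - (S \<union> T) = R" and dTR: "?I - S = T \<union> R"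
    using disj by auto
  show "?l S' B = ?r S' B"
  proof (cases "S' = S \<and> bilinear_form (val p S) (val (cauchy q r) (T \<union> R)) B")
    case True
    then have S': "S' = S" and B: "bilinear_form (val p S) (val (cauchy q r) (T \<union> R)) B" by auto
    note b = bilinear_mapD[OF bilinear_map_pure_cauchy[OF disj(3) refl, of q r], unfolded snd_conv fst_conv]
    note B' = bilinear_mapD[OF B, unfolded snd_conv fst_conv]
    have in1: "bilinear_form (val p S) (val q T) (\<lambda>x y. B x (pure_cauchy q r T R y z))"
      if "z \<in> obj r R" for z
      by (rule bilinear_mapI) (use that in \<open>simp_all add: b B'\<close>)
    have G: "bilinear_form (val (cauchy p q) (S \<union> T)) (val r R)
               (\<lambda>u z. u S (\<lambda>x y. B x (pure_cauchy q r T R y z)))"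
    proof (rule bilinear_mapI, goal_cases)
      case (3 u z z')
      then have u: "u S \<in> snd (tensor_product (val p S) (val q T))"
        using cauchy_component[of u p q "S \<union> T" S] dT by auto
      have "u S (\<lambda>x y. B x (pure_cauchy q r T R y (z + z'))) =
            u S (\<lambda>x y. B x (pure_cauchy q r T R y z) + B x (pure_cauchy q r T R y z'))"
        by (rule tensor_apply_cong[OF vsp u]) (use 3 in \<open>simp add: b B'\<close>)
      then show ?case using 3 tensor_apply_add[OF u in1 in1] by simp
    next
      case (5 c u z)
      then have u: "u S \<in> snd (tensor_product (val p S) (val q T))"
        using cauchy_component[of u p q "S \<union> T" S] dT by auto
      have "u S (\<lambda>x y. B x (pure_cauchy q r T R y (scl r c z))) =
            u S (\<lambda>x y. c * B x (pure_cauchy q r T R y z))"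
        by (rule tensor_apply_cong[OF vsp u]) (use 5 in \<open>simp add: b B'\<close>)
      then show ?case using 5 tensor_apply_scale[OF u in1] by simp
    qed (simp_all add: cauchy_def tensor_scale_def)
    show ?thesis
      using * B S' in1[OF z] G
      by (simp add: dT dR dTR) (simp add: pure_cauchy_def[of "cauchy p q"] pure_cauchy_def[of p] summand_def pure_tensor_def)
  next
    case False
    show ?thesis
    proof (cases "S' \<subseteq> S \<union> T \<and> bilinear_form (val p S') (val (cauchy q r) (?I - S')) B")
      case True
      with False dTR have "S' \<noteq> S" by auto
      with True * show ?thesis
        by (simp add: pure_cauchy_def[of "cauchy p q"] pure_cauchy_def[of p] summand_def pure_tensor_def)
    next
      case F: False
      have "?l S' B = 0" using F ** by (cases "S' \<subseteq> S \<union> T") (auto simp: cauchy_assoc_def)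
      moreover have "?r S' B = 0" using False by (auto simp: pure_cauchy_def[of p] summand_def pure_tensor_def)
      ultimately show ?thesis by simp
    qed
  qed
qed

lemma cauchy_interchange_pure:
  assumes fin: "finite A" "finite C" "finite D" "finite E"
    and disj: "A \<inter> C = {}" "A \<inter> D = {}" "A \<inter> E = {}" "C \<inter> D = {}" "C \<inter> E = {}" "D \<inter> E = {}"
    and vsp: "is_vsp (val r D)" "is_vsp (val s E)"
    and x: "x \<in> obj p A" and y: "y \<in> obj q C" and x': "x' \<in> obj r D" and y': "y' \<in> obj s E"
  shows "cauchy_interchange p q r s (A \<union> C \<union> D \<union> E)
           (pure_cauchy (cauchy p q) (cauchy r s) (A \<union> C) (D \<union> E)
              (pure_cauchy p q A C x y) (pure_cauchy r s D E x' y')) =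
         pure_cauchy (cauchy p r) (cauchy q s) (A \<union> D) (C \<union> E)
           (pure_cauchy p r A D x x') (pure_cauchy q s C E y y')" (is "?l = ?r")
proof (intro ext)
  fix S' and B :: "('a, 'b, 'g, 'c) cauchy \<Rightarrow> ('a, 'b, 'i, 'e) cauchy \<Rightarrow> 'b"
  let ?I = "A \<union> C \<union> D \<union> E"
  let ?t = "pure_cauchy (cauchy p q) (cauchy r s) (A \<union> C) (D \<union> E)
              (pure_cauchy p q A C x y) (pure_cauchy r s D E x' y')"
  let ?F = "\<lambda>S u w. u (S \<inter> S') (\<lambda>x y. w (S' - S) (\<lambda>x' y'.
                      B (pure_cauchy p r (S \<inter> S') (S' - S) x x')
                        (pure_cauchy q s (S - S') (?I - S - S') y y')))"
  have *: "?l S' B = ?t (A \<union> C) (?F (A \<union> C))"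
    if "S' \<subseteq> ?I" "bilinear_form (val (cauchy p r) S') (val (cauchy q s) (?I - S')) B"
  proof -
    have "?l S' B = (\<Sum>S | S \<subseteq> ?I. ?t S (?F S))"
      using that by (auto simp: cauchy_interchange_def)
    also have "\<dots> = (\<Sum>S | S \<subseteq> ?I. if S = A \<union> C then ?t (A \<union> C) (?F (A \<union> C)) else 0)"
      by (rule sum.cong) (auto simp: pure_cauchy_def[of "cauchy p q"] summand_def)
    also have "\<dots> = ?t (A \<union> C) (?F (A \<union> C))"
      using that fin by (subst sum.delta) auto
    finally show ?thesis .
  qed
  have d: "(A \<union> C) \<inter> (A \<union> D) = A" "A \<union> D - (A \<union> C) = D" "A \<union> C - (A \<union> D) = C"
    "?I - (A \<union> C) - (A \<union> D) = E" "?I - (A \<union> D) = C \<union> E" "A \<union> C - A = C" "D \<union> E - D = E"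
    using disj by auto
  show "?l S' B = ?r S' B"
  proof (cases "S' = A \<union> D \<and> bilinear_form (val (cauchy p r) (A \<union> D)) (val (cauchy q s) (C \<union> E)) B")
    case True
    then have S': "S' = A \<union> D"
      and B: "bilinear_form (val (cauchy p r) (A \<union> D)) (val (cauchy q s) (C \<union> E)) B" by auto
    note b1 = bilinear_mapD[OF bilinear_map_pure_cauchy[OF disj(2) refl, of p r], unfolded snd_conv fst_conv]
    note b2 = bilinear_mapD[OF bilinear_map_pure_cauchy[OF disj(5) refl, of q s], unfolded snd_conv fst_conv]
    note B' = bilinear_mapD[OF B, unfolded snd_conv fst_conv]
    define K where "K x y = (\<lambda>x' y'. B (pure_cauchy p r A D x x') (pure_cauchy q s C E y y'))" for x y
    have K: "bilinear_form (val r D) (val s E) (K x y)" if "x \<in> obj p A" "y \<in> obj q C" for x y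
      by (rule bilinear_mapI) (use that in \<open>simp_all add: b1 b2 B' K_def\<close>)
    have w: "w D \<in> snd (tensor_product (val r D) (val s E))" if "w \<in> obj (cauchy r s) (D \<union> E)" for w
      using cauchy_component[OF that, of D] d by auto
    have K2: "bilinear_form (val p A) (val q C) (\<lambda>x y. w D (K x y))"
      if "w \<in> obj (cauchy r s) (D \<union> E)" for w
    proof (rule bilinear_mapI, goal_cases)
      case (2 x1 x2 y)
      have "w D (K (x1 + x2) y) = w D (\<lambda>x' y'. K x1 y x' y' + K x2 y x' y')"
        by (rule tensor_apply_cong[OF vsp w[OF that]]) (use 2 in \<open>simp add: b1 b2 B' K_def\<close>)
      then show ?case using 2 tensor_apply_add[OF w[OF that] K K] by simp
    next
      case (3 x y1 y2)
      have "w D (K x (y1 + y2)) = w D (\<lambda>x' y'. K x y1 x' y' + K x y2 x' y')"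
        by (rule tensor_apply_cong[OF vsp w[OF that]]) (use 3 in \<open>simp add: b1 b2 B' K_def\<close>)
      then show ?case using 3 tensor_apply_add[OF w[OF that] K K] by simp
    next
      case (4 c x y)
      have "w D (K (scl p c x) y) = w D (\<lambda>x' y'. c * K x y x' y')"
        by (rule tensor_apply_cong[OF vsp w[OF that]]) (use 4 in \<open>simp add: b1 b2 B' K_def\<close>)
      then show ?case using 4 tensor_apply_scale[OF w[OF that] K] by simp
    next
      case (5 c x y)
      have "w D (K x (scl q c y)) = w D (\<lambda>x' y'. c * K x y x' y')"
        by (rule tensor_apply_cong[OF vsp w[OF that]]) (use 5 in \<open>simp add: b1 b2 B' K_def\<close>)
      then show ?case using 5 tensor_apply_scale[OF w[OF that] K] by simp
    qed simp
    have u: "u A \<in> snd (tensor_product (val p A) (val q C))" if "u \<in> obj (cauchy p q) (A \<union> C)" for u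
      using cauchy_component[OF that, of A] d by auto
    have G: "bilinear_form (val (cauchy p q) (A \<union> C)) (val (cauchy r s) (D \<union> E))
               (\<lambda>u w. u A (\<lambda>x y. w D (K x y)))"
    proof (rule bilinear_mapI, goal_cases)
      case (3 v w w')
      then show ?case using tensor_apply_add[OF u K2 K2, of v w w'] by simp
    next
      case (5 c v w)
      then show ?case using tensor_apply_scale[OF u K2, of v w c] by (simp add: cauchy_def tensor_scale_def)
    qed (simp_all add: cauchy_def tensor_scale_def)
    have "pure_cauchy r s D E x' y' \<in> obj (cauchy r s) (D \<union> E)"
      using bilinear_mapD(1)[OF bilinear_map_pure_cauchy[OF disj(6) refl, of r s]] x' y' by simp
    note K2' = K2[OF this]
    have "?l S' B = ?t (A \<union> C) (\<lambda>u w. u A (\<lambda>x y. w D (K x y)))"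
      using * B S' by (simp only: d K_def) blast
    also have "\<dots> = pure_tensor (val p A) (val q C) x y (\<lambda>x y. pure_cauchy r s D E x' y' D (K x y))"
      using G by (simp add: pure_cauchy_def[of "cauchy p q"] pure_cauchy_def[of p] summand_def)
        (simp add: pure_tensor_def[of "val (cauchy p q) (A \<union> C)"])
    also have "\<dots> = K x y x' y'"
      using K2' K[OF x y] by (simp add: pure_tensor_def[of "val p A"])
        (simp add: pure_cauchy_def summand_def pure_tensor_def)
    also have "\<dots> = ?r S' B"
      using S' B by (simp add: pure_cauchy_def[of "cauchy p r"] summand_def)
        (simp add: pure_tensor_def[of "val (cauchy p r) (A \<union> D)"] K_def)
    finally show ?thesis .
  next
    case False
    then have r0: "?r S' B = 0"
      by (auto simp: pure_cauchy_def[of "cauchy p r"] summand_def)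
        (auto simp: pure_tensor_def[of "val (cauchy p r) (A \<union> D)"])
    show ?thesis
    proof (cases "S' \<subseteq> ?I \<and> bilinear_form (val (cauchy p r) S') (val (cauchy q s) (?I - S')) B")
      case True
      with False d have "S' \<noteq> A \<union> D" by auto
      then have ne: "(A \<union> C) \<inter> S' \<noteq> A \<or> S' - (A \<union> C) \<noteq> D" by auto
      have "?F (A \<union> C) (pure_cauchy p q A C x y) (pure_cauchy r s D E x' y') = 0"
      proof (cases "(A \<union> C) \<inter> S' = A")
        case False
        then have "pure_cauchy p q A C x y ((A \<union> C) \<inter> S') = 0"
          by (simp only: pure_cauchy_def[of p q] summand_def if_False)
        then show ?thesis by (simp only: zero_fun_apply)
      next
        case True
        with ne have "pure_cauchy r s D E x' y' (S' - (A \<union> C)) = 0"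
          by (simp only: pure_cauchy_def[of r s] summand_def if_False simp_thms)
        moreover have "pure_cauchy p q A C x y A (\<lambda>x y. 0) = 0"
          by (simp add: pure_cauchy_def summand_def pure_tensor_def)
        ultimately show ?thesis by (simp only: zero_fun_apply True)
      qed
      then have "?t (A \<union> C) (?F (A \<union> C)) = 0"
        by (simp add: pure_cauchy_def[of "cauchy p q"] summand_def)
          (simp add: pure_tensor_def[of "val (cauchy p q) (A \<union> C)"])
      with True * r0 show ?thesis by simp
    next
      case F: False
      then have "?l S' B = 0" by (auto simp: cauchy_interchange_def)
      with r0 show ?thesis by simp
    qed
  qed
qed

end

theory Submission
  imports Defs "HOL-Library.FuncSet"
begin

text \<open>
  Write \<open>\<delta> : h \<rightarrow> k \<cdot> h\<close> for the induced coaction and \<open>K\<close> for the Hopf kernel. Averaging a linear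
  projection gives a natural retraction \<open>\<rho> : h \<rightarrow> K\<close>, and \<open>\<phi> = (id \<cdot> \<rho>) \<circ> \<delta> : h \<rightarrow> k \<cdot> K\<close> is a morphism
  of comodules. It is surjective because for \<open>b \<in> h[S]\<close> and \<open>x \<in> K[T]\<close> the element \<open>\<phi>(b x)\<close> is
  \<open>\<pi>(b) \<otimes> x\<close> plus terms in \<open>k[S'] \<otimes> K[T']\<close> with \<open>S'\<close> strictly contained in \<open>S\<close>. It is injective by
  induction on the cardinality of \<open>I\<close>: if \<open>\<phi>(x) = 0\<close>, then \<open>(id \<cdot> \<phi>)(\<delta>(x)) = 0\<close>, hence \<open>\<delta>(x)\<close>
  vanishes in all components with nonempty first index, so \<open>x \<in> K\<close> and \<open>1 \<otimes> x = \<phi>(x) = 0\<close>. That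
  \<open>k \<cdot> K\<close> is a species and a comodule is transported from \<open>h\<close> along \<open>\<phi>\<close>.
\<close>

section \<open>Tensor products\<close>

text \<open>The map \<open>(id \<cdot> \<rho>) \<circ> \<delta>\<close> is a comodule morphism for
  any species morphism \<open>\<rho>\<close>, by the universal property of the cofree comodule. So
  \<open>\<rho>\<close> has to commute with bijections but not with coactions; naturality is what
  forces the averaging and brings in characteristic 0. The leading term of
  \<open>\<phi>(b x)\<close> comes from \<open>\<Delta>(b x) = \<Delta>(b) \<Delta>(x)\<close>: as
  \<open>\<delta>(x)\<close> lives only over the empty set, the first index receives nothing from
  \<open>T\<close>, and connectedness turns the factors over the empty set into the unit. Cancelling
  \<open>\<phi>\<close> on \<open>I - S\<close> takes a linear inverse on all of
  \<open>(k \<cdot> K)[I - S]\<close>, which is why surjectivity precedes injectivity. Transport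
  along \<open>\<phi>\<close> avoids a direct check of functoriality and finite dimension of a
  Cauchy product and of a pentagon identity for \<open>cauchy_assoc\<close>. Tensors are functionals
  on bilinear forms, so identities are proved by evaluating at a form \<open>B\<close>. Most of the
  labour is to show that the pulled-back forms are bilinear again: otherwise the default value 0 is
  returned.\<close>

lemma linear_mapI:
  assumes "\<And>x. x \<in> snd V \<Longrightarrow> f x \<in> snd W"
    and "\<And>x y. x \<in> snd V \<Longrightarrow> y \<in> snd V \<Longrightarrow> f (x + y) = f x + f y"
    and "\<And>c x. x \<in> snd V \<Longrightarrow> f (fst V c x) = fst W c (f x)"
  shows "linear_map V W f"
  using assms by (auto simp: linear_map_def)

lemma linear_mapD:
  assumes "linear_map V W f"
  shows "\<And>x. x \<in> snd V \<Longrightarrow> f x \<in> snd W"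
    and "\<And>x y. x \<in> snd V \<Longrightarrow> y \<in> snd V \<Longrightarrow> f (x + y) = f x + f y"
    and "\<And>c x. x \<in> snd V \<Longrightarrow> f (fst V c x) = fst W c (f x)"
  using assms by (auto simp: linear_map_def)

lemma linear_map_comp:
  "linear_map V W f \<Longrightarrow> linear_map W U g \<Longrightarrow> linear_map V U (\<lambda>x. g (f x))"
  by (auto simp: linear_map_def)

lemma linear_map_ident: "linear_map V V (\<lambda>x. x)"
  by (auto simp: linear_map_def)

lemma bilinear_map_linear_left: "bilinear_map V W U b \<Longrightarrow> y \<in> snd W \<Longrightarrow> linear_map V U (\<lambda>x. b x y)"
  by (simp add: bilinear_map_def)

lemma bilinear_map_linear_right: "bilinear_map V W U b \<Longrightarrow> x \<in> snd V \<Longrightarrow> linear_map W U (b x)"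
  by (simp add: bilinear_map_def)

lemma bilinear_map_comp:
  assumes "bilinear_map V' W' U B" "linear_map V V' f" "linear_map W W' g"
  shows "bilinear_map V W U (\<lambda>x y. B (f x) (g y))"
  by (rule bilinear_mapI) (simp_all add: bilinear_mapD[OF assms(1)] linear_mapD[OF assms(2)] linear_mapD[OF assms(3)])

lemma bilinear_map_linear_comp:
  assumes "bilinear_map V W U B" "linear_map U U' f"
  shows "bilinear_map V W U' (\<lambda>x y. f (B x y))"
  by (rule bilinear_mapI) (simp_all add: bilinear_mapD[OF assms(1)] linear_mapD[OF assms(2)])

lemma tensor_product_fst [simp]: "fst (tensor_product V W) = tensor_scale"
  by (simp add: tensor_product_def)

lemma tensor_product_closed:
  shows "0 \<in> snd (tensor_product V W)"
    and "t \<in> snd (tensor_product V W) \<Longrightarrow> u \<in> snd (tensor_product V W) \<Longrightarrow> t + u \<in> snd (tensor_product V W)"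
    and "t \<in> snd (tensor_product V W) \<Longrightarrow> tensor_scale c t \<in> snd (tensor_product V W)"
  using is_vsp_closed[OF is_vsp_tensor_product[of V W]] by simp_all

lemma tensor_scale_zero: "tensor_scale c 0 = 0"
  by (simp add: tensor_scale_def fun_eq_iff)

lemma tensor_apply_zero: "t \<in> snd (tensor_product V W) \<Longrightarrow> t (\<lambda>x y. 0) = 0"
  by (induction rule: tensor_induct) (auto simp: tensor_scale_def pure_tensor_def)

text \<open>The default value in \<open>pure_tensor\<close> survives linear combinations. Hence
  identities of tensors hold as equalities of functionals, not merely on bilinear forms, for
  instance in \<open>tensor_map_ident\<close>.\<close>

lemma tensor_apply_not_bilinear:
  "t \<in> snd (tensor_product V W) \<Longrightarrow> \<not> bilinear_form V W B \<Longrightarrow> t B = 0"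
  by (induction rule: tensor_induct) (auto simp: tensor_scale_def pure_tensor_def)

text \<open>Linearity of \<open>f'\<close> and \<open>g'\<close> makes the pulled-back form pass the
  inner guard; after that both sides unfold to the same functional, for arbitrary
  \<open>t\<close>.\<close>

lemma tensor_map_comp:
  assumes "linear_map V' V'' f'" "linear_map W' W'' g'"
  shows "tensor_map V'' W'' f' g' (tensor_map V' W' f g t) =
         tensor_map V'' W'' (\<lambda>x. f' (f x)) (\<lambda>y. g' (g y)) t"
  by (simp add: tensor_map_def bilinear_map_comp[OF _ assms] fun_eq_iff)

lemma tensor_map_cong:
  assumes "is_vsp V" "is_vsp W" "t \<in> snd (tensor_product V W)"
    and "\<And>x. x \<in> snd V \<Longrightarrow> f x = f' x" "\<And>y. y \<in> snd W \<Longrightarrow> g y = g' y"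
  shows "tensor_map V' W' f g t = tensor_map V' W' f' g' t"
  unfolding tensor_map_def by (intro ext if_cong refl tensor_apply_cong[OF assms(1-3)]) (simp add: assms)

lemma tensor_map_ident: "t \<in> snd (tensor_product V W) \<Longrightarrow> tensor_map V W (\<lambda>x. x) (\<lambda>y. y) t = t"
  by (auto simp: tensor_map_def tensor_apply_not_bilinear)

lemma tensor_map_zero [simp]: "tensor_map V W f g 0 = 0"
  by (auto simp: tensor_map_def)

lemma tensor_map_add: "tensor_map V W f g (t + u) = tensor_map V W f g t + tensor_map V W f g u"
  by (auto simp: tensor_map_def)

lemma tensor_map_scale: "tensor_map V W f g (tensor_scale c t) = tensor_scale c (tensor_map V W f g t)"
  by (auto simp: tensor_map_def tensor_scale_def)

lemma tensor_map_in:
  assumes "linear_map V V' f" "linear_map W W' g" "t \<in> snd (tensor_product V W)"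
  shows "tensor_map V' W' f g t \<in> snd (tensor_product V' W')"
  using assms(3)
proof (induction rule: tensor_induct)
  case (pure x y)
  then show ?case
    using assms(1,2) by (simp add: tensor_map_pure pure_tensor_in linear_mapD)
qed (simp_all only: tensor_map_zero tensor_map_add tensor_map_scale tensor_product_closed)

text \<open>Only pure tensors matter, and there \<open>t (K x y)\<close> is \<open>K x y v w\<close>
  for fixed \<open>v\<close> and \<open>w\<close>. The guard in \<open>pure_tensor\<close> opens
  only for \<open>x\<close> and \<open>y\<close> in the carriers, hence the appeal to
  \<open>bilinear_map_cong\<close>.\<close>

lemma bilinear_form_tensor_apply:
  assumes "is_vsp X" "is_vsp Y" "t \<in> snd (tensor_product V W)"
    and "\<And>x y. x \<in> snd X \<Longrightarrow> y \<in> snd Y \<Longrightarrow> bilinear_form V W (K x y)"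
    and "\<And>v w. v \<in> snd V \<Longrightarrow> w \<in> snd W \<Longrightarrow> bilinear_form X Y (\<lambda>x y. K x y v w)"
  shows "bilinear_form X Y (\<lambda>x y. t (K x y))"
  using assms(3)
proof (induction rule: tensor_induct)
  case zero
  show ?case by (rule bilinear_mapI) auto
next
  case (add t u)
  then show ?case using bilinear_form_add by (simp add: plus_fun_def)
next
  case (scale c t)
  then show ?case using bilinear_form_scale by (simp add: tensor_scale_def)
next
  case (pure v w)
  then show ?case
    using bilinear_map_cong[OF assms(1,2), of "\<lambda>x y. pure_tensor V W v w (K x y)" "\<lambda>x y. K x y v w"]
      assms(4) assms(5)[OF pure] by (simp add: pure_tensor_def)
qed

text \<open>Linearity in \<open>t\<close> is automatic for functionals. Linearity in
  \<open>z\<close> is known only where the arguments of \<open>K z\<close> lie in \<open>V\<close>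
  and \<open>W\<close>, so it has to pass through \<open>tensor_apply_cong\<close>.\<close>

lemma bilinear_form_tensor_eval:
  assumes "is_vsp V" "is_vsp W"
    and "\<And>z. z \<in> snd Z \<Longrightarrow> bilinear_form V W (K z)"
    and "\<And>v w. v \<in> snd V \<Longrightarrow> w \<in> snd W \<Longrightarrow> linear_map Z scalar_vsp (\<lambda>z. K z v w)"
  shows "bilinear_form (tensor_product V W) Z (\<lambda>t z. t (K z))"
proof (rule bilinear_mapI, goal_cases)
  case (3 t z z')
  have "t (K (z + z')) = t (\<lambda>x y. K z x y + K z' x y)"
    by (rule tensor_apply_cong[OF assms(1,2) 3(1)]) (use 3 in \<open>simp add: linear_mapD(2)[OF assms(4)]\<close>)
  then show ?case using tensor_apply_add[OF 3(1) assms(3) assms(3)] 3 by simp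
next
  case (5 c t z)
  have "t (K (fst Z c z)) = t (\<lambda>x y. c * K z x y)"
    by (rule tensor_apply_cong[OF assms(1,2) 5(1)]) (use 5 in \<open>simp add: linear_mapD(3)[OF assms(4)]\<close>)
  then show ?case using tensor_apply_scale[OF 5(1) assms(3)] 5 by simp
qed (auto simp: tensor_scale_def)

text \<open>Evaluating at the form \<open>e v * l w\<close> yields \<open>l x\<close>, and linear
  functionals \<open>l\<close> separate points. Applied with \<open>e\<close> the counit, it removes
  the factor \<open>1\<close> from \<open>1 \<otimes> x\<close>.\<close>

lemma pure_tensor_one_eq_0:
  assumes "is_vsp W" "linear_map V scalar_vsp e" "e u = 1" "pure_tensor V W u x = 0"
  shows "x = 0"
proof (rule functional_separates)
  show "vector_space (fst W)" using assms(1) by (simp add: is_vsp_def)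
  fix l assume "Vector_Spaces.linear (fst W) (*) l"
  then have l: "l (x + y) = l x + l y" "l (fst W c x) = c * l x" "l 0 = 0" for x y c
    by (auto simp: linear_iff_module_hom module_hom.add module_hom.scale module_hom.zero)
  have "bilinear_form V W (\<lambda>v w. e v * l w)"
    by (rule bilinear_mapI) (simp_all add: l linear_mapD[OF assms(2)] algebra_simps)
  then have "pure_tensor V W u x (\<lambda>v w. e v * l w) = l x"
    by (simp add: pure_tensor_def assms(3))
  then show "l x = l 0" by (simp add: assms(4) l)
qed

section \<open>Cauchy products\<close>

text \<open>What remains of \<open>species_morphism\<close> without naturality; the calculus of
  \<open>cauchy_map\<close> asks for nothing more.\<close>

definition linear_family ::
    "('a, 'f::field, 'v::ab_group_add, 'y) species_scheme \<Rightarrow>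
     ('a, 'f, 'w::ab_group_add, 'z) species_scheme \<Rightarrow> ('a set \<Rightarrow> 'v \<Rightarrow> 'w) \<Rightarrow> bool" where
  "linear_family p q f \<longleftrightarrow> (\<forall>I. finite I \<longrightarrow> linear_map (val p I) (val q I) (f I))"

text \<open>The part of \<open>is_species\<close> that every \<open>cauchy p q\<close> has by
  construction, so it is available for \<open>k \<cdot> K\<close> before that is known to be a
  species.\<close>

definition vsp_family :: "('a, 'f::field, 'v::ab_group_add, 'z) species_scheme \<Rightarrow> bool" where
  "vsp_family p \<longleftrightarrow> (\<forall>I. finite I \<longrightarrow> is_vsp (val p I))"

lemma linear_familyD: "linear_family p q f \<Longrightarrow> finite I \<Longrightarrow> linear_map (val p I) (val q I) (f I)"
  by (simp add: linear_family_def)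

lemma vsp_familyD: "vsp_family p \<Longrightarrow> finite I \<Longrightarrow> is_vsp (val p I)"
  by (simp add: vsp_family_def)

lemma species_morphism_linear_family: "species_morphism p q f \<Longrightarrow> linear_family p q f"
  by (simp add: species_morphism_def linear_family_def)

lemma is_species_vsp_family: "is_species p \<Longrightarrow> vsp_family p"
  by (simp add: is_species_def vsp_family_def)

lemma linear_family_idm: "linear_family p p idm"
  by (simp add: linear_family_def linear_map_ident)

lemma scl_cauchy: "scl (cauchy p q) c t S = tensor_scale c (t S)"
  by (simp add: cauchy_def)

lemma cauchy_outside: "t \<in> obj (cauchy p q) I \<Longrightarrow> \<not> S \<subseteq> I \<Longrightarrow> t S = 0"
  by (auto simp: cauchy_def split: if_splits)

lemma cauchyI:
  assumes "\<And>S. S \<subseteq> I \<Longrightarrow> t S \<in> snd (tensor_product (val p S) (val q (I - S)))"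
    and "\<And>S. \<not> S \<subseteq> I \<Longrightarrow> t S = 0"
  shows "t \<in> obj (cauchy p q) I"
  using assms by (auto simp: cauchy_def)

lemma is_vsp_cauchy: "is_vsp (val (cauchy p q) I)"
proof -
  have vs: "vector_space (scl (cauchy p q))"
    by unfold_locales (auto simp: cauchy_def tensor_scale_def fun_eq_iff algebra_simps)
  then interpret vector_space "scl (cauchy p q)" .
  have "subspace (obj (cauchy p q) I)"
  proof (rule subspaceI, goal_cases)
    case 1
    show ?case by (rule cauchyI) (simp_all only: zero_fun_apply tensor_product_closed)
  next
    case (2 t u)
    show ?case
      by (rule cauchyI) (use 2 in \<open>simp_all only: plus_fun_apply tensor_product_closed cauchy_component
        cauchy_outside[OF 2(1)] cauchy_outside[OF 2(2)] add_0 not_False_eq_True\<close>)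
  next
    case (3 t c)
    then show ?case
      by (intro cauchyI) (simp_all only: tensor_scale_zero scl_cauchy tensor_product_closed cauchy_component cauchy_outside[OF 3] not_False_eq_True)
  qed
  then show ?thesis by (simp add: is_vsp_def vs)
qed

lemma vsp_family_cauchy: "vsp_family (cauchy p q)"
  by (simp add: vsp_family_def is_vsp_cauchy)

lemma linear_map_cauchy_component:
  "S \<subseteq> I \<Longrightarrow> linear_map (val (cauchy p q) I) (tensor_product (val p S) (val q (I - S))) (\<lambda>t. t S)"
  by (rule linear_mapI) (auto simp: cauchy_component scl_cauchy)

lemma linear_family_cauchy_map:
  assumes f: "linear_family p p' f" and g: "linear_family q q' g"
  shows "linear_family (cauchy p q) (cauchy p' q') (cauchy_map p' q' f g)"
  unfolding linear_family_def
proof (intro allI impI linear_mapI, goal_cases)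
  case (1 I t)
  show ?case unfolding snd_conv
  proof (rule cauchyI)
    fix S assume S: "S \<subseteq> I"
    then have "finite S" "finite (I - S)" using 1 finite_subset by auto
    then show "cauchy_map p' q' f g I t S \<in> snd (tensor_product (val p' S) (val q' (I - S)))"
      using S tensor_map_in[OF linear_familyD[OF f] linear_familyD[OF g] cauchy_component[of t p q I S]] 1
      by (simp add: cauchy_map_def)
  qed (simp add: cauchy_map_def)
qed (auto simp: fun_eq_iff cauchy_map_def tensor_map_add tensor_map_scale scl_cauchy, simp add: tensor_scale_def)

lemma cauchy_map_comp:
  assumes "linear_family p' p'' f'" "linear_family q' q'' g'" "finite I"
  shows "cauchy_map p'' q'' f' g' I (cauchy_map p' q' f g I t) =
         cauchy_map p'' q'' (\<lambda>S x. f' S (f S x)) (\<lambda>S y. g' S (g S y)) I t"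
  using assms(3)
  by (auto simp: cauchy_map_def fun_eq_iff finite_subset
      tensor_map_comp[OF linear_familyD[OF assms(1)] linear_familyD[OF assms(2)]])

lemma cauchy_map_cong:
  assumes "vsp_family p" "vsp_family q" "finite I" "t \<in> obj (cauchy p q) I"
    and "\<And>S x. S \<subseteq> I \<Longrightarrow> x \<in> obj p S \<Longrightarrow> f S x = f' S x"
    and "\<And>S y. S \<subseteq> I \<Longrightarrow> y \<in> obj q S \<Longrightarrow> g S y = g' S y"
  shows "cauchy_map p' q' f g I t = cauchy_map p' q' f' g' I t"
proof
  fix S
  show "cauchy_map p' q' f g I t S = cauchy_map p' q' f' g' I t S"
  proof (cases "S \<subseteq> I")
    case True
    then have "finite S" "finite (I - S)" using assms(3) finite_subset by auto
    note v = vsp_familyD[OF assms(1) this(1)] vsp_familyD[OF assms(2) this(2)]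
    show ?thesis using True assms(5,6)
      by (auto simp: cauchy_map_def intro!: tensor_map_cong[OF v cauchy_component[OF assms(4) True]])
  qed (simp add: cauchy_map_def)
qed

lemma cauchy_map_zero [simp]: "cauchy_map p q f g I 0 = 0"
  by (auto simp: cauchy_map_def)

lemma cauchy_map_pure:
  assumes "linear_family p p' f" "linear_family q q' g" "finite S" "finite T" "S \<inter> T = {}"
    and "x \<in> obj p S" "y \<in> obj q T"
  shows "cauchy_map p' q' f g (S \<union> T) (pure_cauchy p q S T x y) = pure_cauchy p' q' S T (f S x) (g T y)"
proof -
  have "S \<union> T - S = T" using assms by auto
  then show ?thesis
    using tensor_map_pure[OF linear_familyD[OF assms(1,3)] linear_familyD[OF assms(2,4)]] assms(6,7)
    by (auto simp: cauchy_map_def pure_cauchy_def summand_def)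
qed

section \<open>Morphisms of species and naturality of their Cauchy products\<close>

lemma species_morphism_comp:
  "species_morphism p q f \<Longrightarrow> species_morphism q r g \<Longrightarrow> species_morphism p r (\<lambda>I x. g I (f I x))"
  unfolding species_morphism_def by (metis linear_map_comp linear_mapD(1) snd_conv)

lemma species_morphism_idm: "species_morphism p p idm"
  by (simp add: species_morphism_def linear_map_ident)

lemma relabel_linear: "is_species p \<Longrightarrow> finite I \<Longrightarrow> inj_on \<sigma> I \<Longrightarrow> linear_map (val p I) (val p (\<sigma> ` I)) (relabel p I \<sigma>)"
  by (simp add: is_species_def)

lemma species_morphism_relabel:
  "species_morphism p q f \<Longrightarrow> finite I \<Longrightarrow> inj_on \<sigma> I \<Longrightarrow> x \<in> obj p I \<Longrightarrow>
   f (\<sigma> ` I) (relabel p I \<sigma> x) = relabel q I \<sigma> (f I x)"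
  by (simp add: species_morphism_def)

text \<open>At \<open>S'\<close> both sides are tensor maps applied to the component of
  \<open>t\<close> at the preimage of \<open>S'\<close> under \<open>\<sigma>\<close>. Functoriality
  of \<open>tensor_map\<close> reduces the claim to naturality of \<open>f\<close> on that preimage
  and of \<open>g\<close> on its complement.\<close>

lemma species_morphism_cauchy_map:
  fixes p :: "('a::infinite, 'f::field_char_0, 'v::ab_group_add, 'z) species_scheme"
  assumes p: "is_species p" "is_species q" "is_species p'" "is_species q'"
    and f: "species_morphism p p' f" and g: "species_morphism q q' g"
  shows "species_morphism (cauchy p q) (cauchy p' q') (cauchy_map p' q' f g)"
  unfolding species_morphism_def
proof (intro conjI allI impI ballI)
  note lf = species_morphism_linear_family[OF f] and lg = species_morphism_linear_family[OF g]
  show "linear_map (val (cauchy p q) I) (val (cauchy p' q') I) (cauchy_map p' q' f g I)" if "finite I" for I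
    using linear_family_cauchy_map[OF lf lg] that by (simp add: linear_family_def)
  fix I t and \<sigma> :: "'a \<Rightarrow> 'a" assume "finite I \<and> inj_on \<sigma> I" and t: "t \<in> obj (cauchy p q) I"
  then have I: "finite I" and \<sigma>: "inj_on \<sigma> I" by auto
  show "cauchy_map p' q' f g (\<sigma> ` I) (relabel (cauchy p q) I \<sigma> t) =
        relabel (cauchy p' q') I \<sigma> (cauchy_map p' q' f g I t)"
  proof
    fix S'
    show "cauchy_map p' q' f g (\<sigma> ` I) (relabel (cauchy p q) I \<sigma> t) S' =
        relabel (cauchy p' q') I \<sigma> (cauchy_map p' q' f g I t) S'"
    proof (cases "S' \<subseteq> \<sigma> ` I")
      case True
      define S where "S = {i \<in> I. \<sigma> i \<in> S'}"
      have S: "S \<subseteq> I" "finite S" "finite (I - S)" "inj_on \<sigma> S" "inj_on \<sigma> (I - S)"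
        using I \<sigma> by (auto simp: S_def inj_on_def)
      have im: "\<sigma> ` S = S'" "\<sigma> ` (I - S) = \<sigma> ` I - S'" using True by (auto simp: S_def)
      have fin': "finite S'" "finite (\<sigma> ` I - S')" using I True finite_subset by auto
      note lin = linear_familyD[OF lf fin'(1)] linear_familyD[OF lg fin'(2)]
        relabel_linear[OF p(3) S(2,4), unfolded im] relabel_linear[OF p(4) S(3,5), unfolded im]
      note v = vsp_familyD[OF is_species_vsp_family[OF p(1)] S(2)]
        vsp_familyD[OF is_species_vsp_family[OF p(2)] S(3)]
      have tS: "t S \<in> snd (tensor_product (val p S) (val q (I - S)))"
        using cauchy_component[OF t S(1)] .
      show ?thesis
        using True S(1)
        by (simp add: cauchy_map_def cauchy_def Let_def S_def[symmetric] tensor_map_comp[OF lin(1,2)]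
              tensor_map_comp[OF lin(3,4)])
          (intro tensor_map_cong[OF v tS],
           auto simp: species_morphism_relabel[OF f S(2,4), unfolded im] species_morphism_relabel[OF g S(3,5), unfolded im])
    qed (simp add: cauchy_map_def cauchy_def)
  qed
qed

text \<open>These are the inner and the outer form that \<open>cauchy_assoc\<close> hands to
  \<open>u S\<close> and \<open>t U\<close>. Their bilinearity opens the guards in
  \<open>tensor_map\<close> when the associator is composed with \<open>cauchy_map\<close>.\<close>

lemma bilinear_form_assoc:
  assumes "finite U" "S \<subseteq> U" "U \<inter> R = {}" "vsp_family p" "vsp_family q"
    and B: "bilinear_form (val p S) (val (cauchy q r) (U - S \<union> R)) B"
  shows "z \<in> obj r R \<Longrightarrow> bilinear_form (val p S) (val q (U - S)) (\<lambda>x y. B x (pure_cauchy q r (U - S) R y z))" (is "_ \<Longrightarrow> ?A z")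
    and "bilinear_form (val (cauchy p q) U) (val r R) (\<lambda>u z. u S (\<lambda>x y. B x (pure_cauchy q r (U - S) R y z)))"
proof -
  have "finite S" "finite (U - S)" using assms finite_subset by auto
  note v = vsp_familyD[OF assms(4) this(1)] vsp_familyD[OF assms(5) this(2)]
  have "(U - S) \<inter> R = {}" using assms(3) by auto
  note pc = bilinear_map_pure_cauchy[OF this refl, of q r]
  show 1: "?A z" if "z \<in> obj r R" for z
    by (rule bilinear_map_comp[OF B linear_map_ident bilinear_map_linear_left[OF pc]]) (simp add: that)
  have "bilinear_form (tensor_product (val p S) (val q (U - S))) (val r R)
          (\<lambda>t z. t (\<lambda>x y. B x (pure_cauchy q r (U - S) R y z)))"
    by (rule bilinear_form_tensor_eval[OF v])
      (auto intro!: 1 linear_map_comp[OF bilinear_map_linear_right[OF pc] bilinear_map_linear_right[OF B]])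
  from bilinear_map_comp[OF this linear_map_cauchy_component[OF assms(2)] linear_map_ident]
  show "bilinear_form (val (cauchy p q) U) (val r R) (\<lambda>u z. u S (\<lambda>x y. B x (pure_cauchy q r (U - S) R y z)))" .
qed

text \<open>Evaluated at \<open>S\<close> and \<open>B\<close>, both sides become one sum over
  \<open>U\<close>, taken at the pullback of \<open>B\<close> along \<open>f\<close> and
  \<open>cauchy_map q' r' g e\<close>. The summands agree because \<open>cauchy_map\<close> acts
  factorwise on \<open>pure_cauchy\<close>.\<close>

lemma cauchy_assoc_natural:
  assumes v: "vsp_family p" "vsp_family q" "vsp_family r" "vsp_family p'" "vsp_family q'"
    and f: "linear_family p p' f" and g: "linear_family q q' g" and e: "linear_family r r' e"
    and I: "finite I" and t: "t \<in> obj (cauchy (cauchy p q) r) I"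
  shows "cauchy_assoc p' q' r' I (cauchy_map (cauchy p' q') r' (cauchy_map p' q' f g) e I t) =
         cauchy_map p' (cauchy q' r') f (cauchy_map q' r' g e) I (cauchy_assoc p q r I t)" (is "?l = ?r")
proof (intro ext)
  fix S B
  note qr = linear_family_cauchy_map[OF g e]
  show "?l S B = ?r S B"
  proof (cases "S \<subseteq> I \<and> bilinear_form (val p' S) (val (cauchy q' r') (I - S)) B")
    case True
    then have S: "S \<subseteq> I" and B: "bilinear_form (val p' S) (val (cauchy q' r') (I - S)) B" by auto
    have fS: "finite S" "finite (I - S)" using S I finite_subset by auto
    have B': "bilinear_form (val p S) (val (cauchy q r) (I - S)) (\<lambda>x y. B (f S x) (cauchy_map q' r' g e (I - S) y))"
      by (rule bilinear_map_comp[OF B linear_familyD[OF f fS(1)] linear_familyD[OF qr fS(2)]])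
    have "?l S B = (\<Sum>U | S \<subseteq> U \<and> U \<subseteq> I.
             t U (\<lambda>u z. u S (\<lambda>x y. B (f S x) (cauchy_map q' r' g e (I - S) (pure_cauchy q r (U - S) (I - U) y z)))))"
      using True unfolding cauchy_assoc_def
    proof (simp, intro sum.cong refl, clarify)
      fix U assume U: "S \<subseteq> U" "U \<subseteq> I"
      have fU: "finite U" "finite (I - U)" "finite (U - S)" using finite_subset[OF U(2) I] I by auto
      have eq: "U - S \<union> (I - U) = I - S" using U by auto
      have disj: "U \<inter> (I - U) = {}" "(U - S) \<inter> (I - U) = {}" by auto
      note bf = bilinear_form_assoc[OF fU(1) U(1) disj(1) v(4,5), unfolded eq, OF B]
      note tU = cauchy_component[OF t U(2)]
      have "cauchy_map (cauchy p' q') r' (cauchy_map p' q' f g) e I t U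
              (\<lambda>u z. u S (\<lambda>x y. B x (pure_cauchy q' r' (U - S) (I - U) y z))) =
            t U (\<lambda>u z. cauchy_map p' q' f g U u S (\<lambda>x y. B x (pure_cauchy q' r' (U - S) (I - U) y (e (I - U) z))))"
        using U bf(2) by (simp add: cauchy_map_def[of "cauchy p' q'"] tensor_map_def)
      also have "\<dots> = t U (\<lambda>u z. u S (\<lambda>x y. B (f S x) (cauchy_map q' r' g e (I - S) (pure_cauchy q r (U - S) (I - U) y z))))"
      proof (rule tensor_apply_cong[OF is_vsp_cauchy vsp_familyD[OF v(3) fU(2)] tU])
        fix u z assume "u \<in> snd (val (cauchy p q) U)" and "z \<in> snd (val r (I - U))"
        then have u: "u \<in> obj (cauchy p q) U" and z: "z \<in> obj r (I - U)" by auto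
        have ez: "e (I - U) z \<in> obj r' (I - U)" using linear_mapD(1)[OF linear_familyD[OF e fU(2)]] z by simp
        have "cauchy_map p' q' f g U u S (\<lambda>x y. B x (pure_cauchy q' r' (U - S) (I - U) y (e (I - U) z))) =
              u S (\<lambda>x y. B (f S x) (pure_cauchy q' r' (U - S) (I - U) (g (U - S) y) (e (I - U) z)))"
          using U bf(1)[OF ez] by (simp add: cauchy_map_def tensor_map_def)
        also have "\<dots> = u S (\<lambda>x y. B (f S x) (cauchy_map q' r' g e (I - S) (pure_cauchy q r (U - S) (I - U) y z)))"
          by (rule tensor_apply_cong[OF vsp_familyD[OF v(1) fS(1)] vsp_familyD[OF v(2) fU(3)] cauchy_component[OF u U(1)]])
            (use cauchy_map_pure[OF g e fU(3,2) disj(2)] z in \<open>simp add: eq\<close>)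
        finally show "cauchy_map p' q' f g U u S (\<lambda>x y. B x (pure_cauchy q' r' (U - S) (I - U) y (e (I - U) z))) =
              u S (\<lambda>x y. B (f S x) (cauchy_map q' r' g e (I - S) (pure_cauchy q r (U - S) (I - U) y z)))" .
      qed
      finally show "cauchy_map (cauchy p' q') r' (cauchy_map p' q' f g) e I t U
              (\<lambda>u z. u S (\<lambda>x y. B x (pure_cauchy q' r' (U - S) (I - U) y z))) =
            t U (\<lambda>u z. u S (\<lambda>x y. B (f S x) (cauchy_map q' r' g e (I - S) (pure_cauchy q r (U - S) (I - U) y z))))" .
    qed
    also have "\<dots> = ?r S B"
      using S B B' by (simp add: cauchy_map_def[of p'] tensor_map_def cauchy_assoc_def)
    finally show ?thesis .
  next
    case False
    then show ?thesis by (auto simp: cauchy_map_def[of p'] tensor_map_def cauchy_assoc_def)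
  qed
qed

lemma cauchy_assoc_zero [simp]: "cauchy_assoc p q r I 0 = 0"
  by (simp add: cauchy_assoc_def fun_eq_iff)

section \<open>Linear algebra of species\<close>

lemma finite_dim_subspace:
  assumes "is_vsp (s, K)" "finite_dim_vsp (s, V)" "K \<subseteq> V"
  shows "finite_dim_vsp (s, K)"
proof -
  interpret vector_space s using assms(1) by (simp add: is_vsp_def)
  have K: "subspace K" using assms(1) by (simp add: is_vsp_def)
  obtain B where B: "finite B" "V = span B" using assms(2) by (auto simp: finite_dim_vsp_def)
  obtain C where C: "C \<subseteq> K" "independent C" "K \<subseteq> span C"
    using maximal_independent_subset by metis
  then have "finite C" using independent_span_bound[of B C] B assms(3) by blast
  moreover have "K = span C" using C K span_subspace by blast
  ultimately show ?thesis by (auto simp: finite_dim_vsp_def)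
qed

lemma finite_dim_image:
  assumes V: "is_vsp V" "finite_dim_vsp V" and W: "is_vsp W"
    and f: "linear_map V W f" "f ` snd V = snd W"
  shows "finite_dim_vsp W"
proof -
  interpret v: vector_space "fst V" using V(1) by (simp add: is_vsp_def)
  interpret w: vector_space "fst W" using W by (simp add: is_vsp_def)
  obtain B where B: "finite B" "snd V = v.span B" using V(2) by (auto simp: finite_dim_vsp_def)
  note fD = linear_mapD[OF f(1)] and cl = is_vsp_closed[OF V(1)]
  have "x \<in> snd V \<and> f x \<in> w.span (f ` B)" if "x \<in> v.span B" for x
    using that
  proof (induction rule: v.span_induct_alt)
    case base
    show ?case using linear_map_0[OF V(1) f(1)] cl w.span_zero by simp
  next
    case (step c x y)
    then have "x \<in> snd V" using B(2) v.span_base by auto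
    with step show ?case by (simp add: fD cl w.span_add w.span_scale w.span_base)
  qed
  then have "snd W \<subseteq> w.span (f ` B)" using f(2) B(2) by (metis image_subsetI)
  moreover have "w.span (f ` B) \<subseteq> snd W"
    using W fD(1) B(2) v.span_base by (intro w.span_minimal) (auto simp: is_vsp_def)
  ultimately show ?thesis using B(1) by (auto simp: finite_dim_vsp_def)
qed

lemma linear_projection_exists:
  assumes "is_vsp (s, K)"
  shows "\<exists>g. linear_map (s, V) (s, K) g \<and> (\<forall>x\<in>K. g x = x)"
proof -
  interpret vector_space s using assms by (simp add: is_vsp_def)
  interpret vector_space_pair s s ..
  have "Vector_Spaces.linear s s (\<lambda>x. x)" by (simp add: linear_iff_module_hom module_hom_iff module_axioms)
  moreover have "subspace K" using assms by (simp add: is_vsp_def)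
  ultimately obtain g where g: "range g \<subseteq> K" "Vector_Spaces.linear s s g" "\<forall>x\<in>K. g x = x"
    using linear_exists_left_inverse_on[of "\<lambda>x. x" K] by auto
  then have "linear_map (s, V) (s, K) g"
    by (intro linear_mapI) (auto simp: image_subset_iff linear_iff_module_hom module_hom.add module_hom.scale)
  with g(3) show ?thesis by blast
qed

lemma linear_map_sum:
  assumes "is_vsp W" "\<And>a. a \<in> A \<Longrightarrow> linear_map V W (f a)"
  shows "linear_map V W (\<lambda>x. \<Sum>a\<in>A. f a x)"
proof -
  interpret vector_space "fst W" using assms(1) by (simp add: is_vsp_def)
  have "subspace (snd W)" using assms(1) by (simp add: is_vsp_def)
  then show ?thesis
    using linear_mapD[OF assms(2)]
    by (intro linear_mapI) (auto simp: sum.distrib scale_sum_right intro!: subspace_sum sum.cong)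
qed

lemma linear_map_scale:
  assumes "is_vsp W" "linear_map V W f"
  shows "linear_map V W (\<lambda>x. fst W c (f x))"
proof -
  interpret vector_space "fst W" using assms(1) by (simp add: is_vsp_def)
  show ?thesis
    using linear_mapD[OF assms(2)] is_vsp_closed[OF assms(1)]
    by (intro linear_mapI) (auto simp: scale_right_distrib mult.commute)
qed

lemma linear_map_sum_apply:
  assumes "is_vsp V" "linear_map V W f" "\<And>a. a \<in> A \<Longrightarrow> x a \<in> snd V"
  shows "f (\<Sum>a\<in>A. x a) = (\<Sum>a\<in>A. f (x a))"
proof -
  have "(\<Sum>a\<in>A. x a) \<in> snd V \<and> f (\<Sum>a\<in>A. x a) = (\<Sum>a\<in>A. f (x a))"
    using assms(3) linear_mapD[OF assms(2)] is_vsp_closed[OF assms(1)] linear_map_0[OF assms(1,2)]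
    by (induction A rule: infinite_finite_induct) auto
  then show ?thesis ..
qed

lemma relabel_cong:
  "is_species p \<Longrightarrow> finite I \<Longrightarrow> inj_on \<sigma> I \<Longrightarrow> (\<And>i. i \<in> I \<Longrightarrow> \<sigma> i = \<tau> i) \<Longrightarrow> x \<in> obj p I \<Longrightarrow>
   relabel p I \<sigma> x = relabel p I \<tau> x"
  by (simp add: is_species_def)

lemma relabel_comp:
  "is_species p \<Longrightarrow> finite I \<Longrightarrow> inj_on \<sigma> I \<Longrightarrow> inj_on \<tau> (\<sigma> ` I) \<Longrightarrow> x \<in> obj p I \<Longrightarrow>
   relabel p (\<sigma> ` I) \<tau> (relabel p I \<sigma> x) = relabel p I (\<tau> \<circ> \<sigma>) x"
  by (simp add: is_species_def)

lemma relabel_in: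
  "is_species p \<Longrightarrow> finite I \<Longrightarrow> inj_on \<sigma> I \<Longrightarrow> x \<in> obj p I \<Longrightarrow> relabel p I \<sigma> x \<in> obj p (\<sigma> ` I)"
  using linear_mapD(1)[OF relabel_linear] by fastforce

lemma relabel_id: "is_species p \<Longrightarrow> finite I \<Longrightarrow> x \<in> obj p I \<Longrightarrow> relabel p I id x = x"
  by (simp add: is_species_def)

text \<open>
  Maschke's theorem: a linear projection on a representative of each cardinality is transported
  along all bijections to that representative, and averaged.
\<close>

lemma equivariant_retraction_exists:
  fixes p :: "('a::infinite, 'f::field_char_0, 'v::ab_group_add, 'y) species_scheme"
    and q :: "('a, 'f, 'v, 'z) species_scheme"
  assumes p: "is_species p" and q: "is_species q"
    and eq: "scl q = scl p" "relabel q = relabel p"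
    and sub: "\<And>I. finite I \<Longrightarrow> obj q I \<subseteq> obj p I"
  shows "\<exists>\<rho>. species_morphism p q \<rho> \<and> (\<forall>I. finite I \<longrightarrow> (\<forall>x\<in>obj q I. \<rho> I x = x))"
proof -
  have vq: "is_vsp (val q I)" and vp: "is_vsp (val p I)" if "finite I" for I
    using p q that by (auto simp: is_species_def)
  have "\<exists>g. linear_map (val p I) (val q I) g \<and> (\<forall>x\<in>obj q I. g x = x)" if "finite I" for I
    using linear_projection_exists[of "scl p" "obj q I" "obj p I"] vq[OF that] by (simp add: eq)
  then obtain P where P: "\<And>I. finite I \<Longrightarrow> linear_map (val p I) (val q I) (P I)"
      "\<And>I x. finite I \<Longrightarrow> x \<in> obj q I \<Longrightarrow> P I x = x"
    by metis
  have "\<exists>R :: 'a set. finite R \<and> card R = n" for n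
    using infinite_arbitrarily_large[OF infinite_UNIV] by blast
  then obtain rep :: "nat \<Rightarrow> 'a set" where rep: "\<And>n. finite (rep n)" "\<And>n. card (rep n) = n"
    by metis
  define R where "R I = rep (card I)" for I :: "'a set"
  have R: "finite (R I)" for I by (simp add: R_def rep)
  \<comment> \<open>Extensional functions count each bijection once and keep the set finite.\<close>
  define Bij where "Bij I = {\<tau> \<in> I \<rightarrow>\<^sub>E R I. bij_betw \<tau> I (R I)}" for I
  have finB: "finite (Bij I)" if "finite I" for I
    using that R by (simp add: Bij_def finite_PiE)
  have restr: "restrict \<tau> I \<in> Bij I" if "bij_betw \<tau> I (R I)" for I \<tau>
    using that by (auto simp: Bij_def bij_betw_def cong: inj_on_cong)
  have neB: "Bij I \<noteq> {}" if "finite I" for I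
  proof -
    have "card I = card (R I)" by (simp add: R_def rep)
    then obtain \<tau> where "bij_betw \<tau> I (R I)"
      using finite_same_card_bij \<open>finite I\<close> R by blast
    then show ?thesis using restr by blast
  qed
  define cnj where "cnj I \<tau> x = relabel p (R I) (inv_into I \<tau>) (P (R I) (relabel p I \<tau> x))" for I \<tau> x
  \<comment> \<open>Characteristic 0 makes the nonzero number \<open>card (Bij I)\<close> invertible
    in the field.\<close>
  define \<rho> where "\<rho> I x = scl q (inverse (of_nat (card (Bij I)))) (\<Sum>\<tau>\<in>Bij I. cnj I \<tau> x)" for I x
  have \<tau>D: "inj_on \<tau> I" "\<tau> ` I = R I" "inj_on (inv_into I \<tau>) (R I)" "inv_into I \<tau> ` R I = I" if "\<tau> \<in> Bij I" for \<tau> I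
  proof -
    have "bij_betw \<tau> I (R I)" using that by (simp add: Bij_def)
    with bij_betw_inv_into[OF this] show "inj_on \<tau> I" "\<tau> ` I = R I" "inj_on (inv_into I \<tau>) (R I)" "inv_into I \<tau> ` R I = I"
      by (auto simp: bij_betw_def)
  qed
  have cnj_lin: "linear_map (val p I) (val q I) (cnj I \<tau>)" if "finite I" "\<tau> \<in> Bij I" for I \<tau>
  proof -
    note d = \<tau>D[OF that(2)]
    show ?thesis
      unfolding cnj_def
      using linear_map_comp[OF linear_map_comp[OF relabel_linear[OF p that(1) d(1), unfolded d(2)] P(1)[OF R]]
          relabel_linear[OF q R d(3), unfolded d(4)]] by (simp add: eq)
  qed
  have cnj_id: "cnj I \<tau> x = x" if "finite I" "\<tau> \<in> Bij I" "x \<in> obj q I" for I \<tau> x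
  proof -
    note d = \<tau>D[OF that(2)]
    have "relabel p I \<tau> x \<in> obj q (R I)" using relabel_in[OF q that(1) d(1) that(3)] by (simp add: eq d)
    then have "cnj I \<tau> x = relabel q (\<tau> ` I) (inv_into I \<tau>) (relabel q I \<tau> x)"
      by (simp add: cnj_def P R eq d)
    also have "\<dots> = relabel q I (inv_into I \<tau> \<circ> \<tau>) x"
      by (rule relabel_comp[OF q that(1) d(1) _ that(3)]) (simp add: d)
    also have "\<dots> = relabel q I id x"
      by (rule relabel_cong[OF q that(1) _ _ that(3)]) (auto intro!: comp_inj_on simp: d)
    finally show ?thesis using relabel_id[OF q that(1,3)] by simp
  qed
  have \<rho>_lin: "linear_map (val p I) (val q I) (\<rho> I)" if I: "finite I" for I
    unfolding \<rho>_def
    using linear_map_scale[OF vq[OF I] linear_map_sum[OF vq[OF I] cnj_lin[OF I]]] by simp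
  have \<rho>_id: "\<rho> I x = x" if "finite I" "x \<in> obj q I" for I x
  proof -
    interpret vector_space "scl q" using vq[OF that(1)] by (simp add: is_vsp_def)
    have "\<rho> I x = scl q (inverse (of_nat (card (Bij I)))) (scl q (of_nat (card (Bij I))) x)"
      using cnj_id[OF that(1) _ that(2)] by (simp add: \<rho>_def sum_constant_scale)
    then show ?thesis using finB[OF that(1)] neB[OF that(1)] by simp
  qed
  have "\<rho> (\<sigma> ` I) (relabel p I \<sigma> x) = relabel q I \<sigma> (\<rho> I x)"
    if I: "finite I" and \<sigma>: "inj_on \<sigma> I" and x: "x \<in> obj p I" for I \<sigma> x
  proof -
    have fJ: "finite (\<sigma> ` I)" using I by simp
    have RJ: "R (\<sigma> ` I) = R I" using \<sigma> by (simp add: R_def card_image)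
    \<comment> \<open>Precomposition with \<open>\<sigma>\<close> matches the two index sets of the
      averages, since both consist of bijections onto the same \<open>R I\<close>.\<close>
    let ?r = "\<lambda>\<tau>. restrict (\<tau> \<circ> \<sigma>) I"
    have r: "bij_betw ?r (Bij (\<sigma> ` I)) (Bij I)"
    proof (rule bij_betw_byWitness[where f' = "\<lambda>\<tau>. restrict (\<tau> \<circ> inv_into I \<sigma>) (\<sigma> ` I)"])
      show "\<forall>\<tau>\<in>Bij (\<sigma> ` I). restrict (?r \<tau> \<circ> inv_into I \<sigma>) (\<sigma> ` I) = \<tau>"
        using \<sigma> by (auto simp: Bij_def fun_eq_iff restrict_def PiE_def extensional_def inv_into_into f_inv_into_f)
      show "\<forall>\<tau>\<in>Bij I. ?r (restrict (\<tau> \<circ> inv_into I \<sigma>) (\<sigma> ` I)) = \<tau>"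
        using \<sigma> by (auto simp: Bij_def fun_eq_iff restrict_def PiE_def extensional_def)
      have bij\<sigma>: "bij_betw \<sigma> I (\<sigma> ` I)" using \<sigma> by (simp add: bij_betw_def)
      show "?r ` Bij (\<sigma> ` I) \<subseteq> Bij I"
      proof
        fix \<tau> assume "\<tau> \<in> ?r ` Bij (\<sigma> ` I)"
        then obtain \<upsilon> where "\<tau> = ?r \<upsilon>" "bij_betw \<upsilon> (\<sigma> ` I) (R I)" by (auto simp: Bij_def RJ)
        then show "\<tau> \<in> Bij I" using restr[OF bij_betw_trans[OF bij\<sigma>]] by simp
      qed
      show "(\<lambda>\<tau>. restrict (\<tau> \<circ> inv_into I \<sigma>) (\<sigma> ` I)) ` Bij I \<subseteq> Bij (\<sigma> ` I)"
      proof
        fix \<tau> assume "\<tau> \<in> (\<lambda>\<tau>. restrict (\<tau> \<circ> inv_into I \<sigma>) (\<sigma> ` I)) ` Bij I"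
        then obtain \<upsilon> where "\<tau> = restrict (\<upsilon> \<circ> inv_into I \<sigma>) (\<sigma> ` I)" "bij_betw \<upsilon> I (R (\<sigma> ` I))"
          by (auto simp: Bij_def RJ)
        then show "\<tau> \<in> Bij (\<sigma> ` I)" using restr[OF bij_betw_trans[OF bij_betw_inv_into[OF bij\<sigma>]]] by simp
      qed
    qed
    have t: "cnj (\<sigma> ` I) \<tau> (relabel p I \<sigma> x) = relabel q I \<sigma> (cnj I (?r \<tau>) x)" if \<tau>: "\<tau> \<in> Bij (\<sigma> ` I)" for \<tau>
    proof -
      have r\<tau>: "?r \<tau> \<in> Bij I" using r \<tau> by (auto simp: bij_betw_def)
      note d = \<tau>D[OF \<tau>, unfolded RJ] and e = \<tau>D[OF r\<tau>]
      have 1: "relabel p (\<sigma> ` I) \<tau> (relabel p I \<sigma> x) = relabel p I (?r \<tau>) x"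
        unfolding relabel_comp[OF p I \<sigma> d(1) x]
        by (rule relabel_cong[OF p I _ _ x]) (use \<sigma> d in \<open>auto intro!: comp_inj_on\<close>)
      define y where "y = P (R I) (relabel p I (?r \<tau>) x)"
      have y: "y \<in> obj p (R I)"
        using linear_mapD(1)[OF P(1)[OF R]] relabel_in[OF p I e(1) x] sub[OF R] unfolding y_def e(2) by fastforce
      have "cnj (\<sigma> ` I) \<tau> (relabel p I \<sigma> x) = relabel p (R I) (inv_into (\<sigma> ` I) \<tau>) y"
        by (simp add: cnj_def 1 RJ y_def)
      \<comment> \<open>The inverse of \<open>\<tau>\<close> is \<open>\<sigma>\<close> after the
        inverse of \<open>\<tau> \<circ> \<sigma>\<close>; this splits off the relabelling along
        \<open>\<sigma>\<close>.\<close>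
      also have "\<dots> = relabel p (R I) (\<sigma> \<circ> inv_into I (?r \<tau>)) y"
      proof (rule relabel_cong[OF p R d(3) _ y])
        fix i assume "i \<in> R I"
        then obtain j where j: "j \<in> I" "i = \<tau> (\<sigma> j)" using e(2) by auto
        then have "inv_into (\<sigma> ` I) \<tau> i = \<sigma> j" using d(1) by simp
        moreover have "inv_into I (?r \<tau>) i = j" using j e(1) inv_into_f_f[OF e(1) j(1)] by simp
        ultimately show "inv_into (\<sigma> ` I) \<tau> i = (\<sigma> \<circ> inv_into I (?r \<tau>)) i" by simp
      qed
      also have "\<dots> = relabel p I \<sigma> (relabel p (R I) (inv_into I (?r \<tau>)) y)"
        using relabel_comp[OF p R e(3) _ y, of \<sigma>] \<sigma> unfolding e(4) by simp
      finally show ?thesis by (simp add: cnj_def y_def eq)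
    qed
    have tI: "cnj I \<tau> x \<in> obj q I" if "\<tau> \<in> Bij I" for \<tau>
      using linear_mapD(1)[OF cnj_lin[OF I that]] x by simp
    have sumI: "(\<Sum>\<tau>\<in>Bij I. cnj I \<tau> x) \<in> obj q I"
      using linear_mapD(1)[OF linear_map_sum[OF vq[OF I] cnj_lin[OF I]]] x by simp
    have "(\<Sum>\<tau>\<in>Bij (\<sigma> ` I). cnj (\<sigma> ` I) \<tau> (relabel p I \<sigma> x)) = (\<Sum>\<tau>\<in>Bij (\<sigma> ` I). relabel q I \<sigma> (cnj I (?r \<tau>) x))"
      by (intro sum.cong refl t)
    also have "\<dots> = (\<Sum>\<tau>\<in>Bij I. relabel q I \<sigma> (cnj I \<tau> x))"
      by (rule sum.reindex_bij_betw[OF r])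
    also have "\<dots> = relabel q I \<sigma> (\<Sum>\<tau>\<in>Bij I. cnj I \<tau> x)"
      by (rule linear_map_sum_apply[OF vq[OF I] relabel_linear[OF q I \<sigma>], symmetric]) (simp add: tI)
    finally show ?thesis
      using linear_mapD(3)[OF relabel_linear[OF q I \<sigma>]] sumI bij_betw_same_card[OF r] by (simp add: \<rho>_def)
  qed
  then have "species_morphism p q \<rho>" using \<rho>_lin by (simp add: species_morphism_def)
  with \<rho>_id show ?thesis by blast
qed

section \<open>Transport of structure\<close>

lemma linear_map_inv_into:
  assumes "is_vsp V" "linear_map V W f" "bij_betw f (snd V) (snd W)"
  shows "linear_map W V (inv_into (snd V) f)"
proof -
  note cl = is_vsp_closed[OF assms(1)] and f = linear_mapD[OF assms(2)]
  have inj: "inj_on f (snd V)" using assms(3) by (simp add: bij_betw_def)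
  have ex: "\<exists>x\<in>snd V. y = f x" if "y \<in> snd W" for y using assms(3) that by (auto simp: bij_betw_def)
  show ?thesis
  proof (rule linear_mapI)
    show "inv_into (snd V) f y \<in> snd V" if "y \<in> snd W" for y
      using ex[OF that] inj by auto
    show "inv_into (snd V) f (y + z) = inv_into (snd V) f y + inv_into (snd V) f z" if "y \<in> snd W" "z \<in> snd W" for y z
      using ex[OF that(1)] ex[OF that(2)] inj cl f by (metis inv_into_f_f)
    show "inv_into (snd V) f (fst W c y) = fst V c (inv_into (snd V) f y)" if "y \<in> snd W" for c y
      using ex[OF that] inj cl f by (metis inv_into_f_f)
  qed
qed

lemma species_isomorphismD:
  assumes "species_isomorphism p q f"
  shows "species_morphism p q f" "finite I \<Longrightarrow> bij_betw (f I) (obj p I) (obj q I)"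
  using assms by (auto simp: species_isomorphism_def)

text \<open>\<open>q\<close> already carries a relabelling with which \<open>f\<close> commutes, so
  each functor law is pulled back to \<open>p\<close> through the bijections \<open>f I\<close>, and
  \<open>q[I]\<close> is finite-dimensional as an image of \<open>p[I]\<close>. Used for
  \<open>q = k \<cdot> K\<close>.\<close>

lemma is_species_transfer:
  fixes p :: "('a::infinite, 'f::field_char_0, 'v::ab_group_add, 'y) species_scheme"
    and q :: "('a, 'f, 'w::ab_group_add, 'z) species_scheme"
  assumes p: "is_species p" and f: "species_isomorphism p q f" and v: "vsp_family q"
  shows "is_species q"
proof -
  note m = species_isomorphismD(1)[OF f]
  note nat = species_morphism_relabel[OF m]
  note lin = linear_familyD[OF species_morphism_linear_family[OF m]]
  have vp: "is_vsp (val p I)" if "finite I" for I using p that by (simp add: is_species_def)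
  have ex: "\<exists>x\<in>obj p I. y = f I x" if "finite I" "y \<in> obj q I" for y I
    using species_isomorphismD(2)[OF f that(1)] that(2) by (auto simp: bij_betw_def)
  have fin: "f I x \<in> obj q I" if "finite I" "x \<in> obj p I" for I x
    using linear_mapD(1)[OF lin] that by simp
  show ?thesis unfolding is_species_def
  proof (intro conjI allI impI ballI)
    fix I :: "'a set" assume I: "finite I"
    show "is_vsp (val q I)" using v I by (rule vsp_familyD)
    show "finite_dim_vsp (val q I)"
      using I vp p species_isomorphismD(2)[OF f I]
      by (intro finite_dim_image[OF vp[OF I] _ vsp_familyD[OF v I] lin[OF I]]) (auto simp: is_species_def bij_betw_def)
    show "relabel q I id y = y" if "y \<in> obj q I" for y
      using ex[OF I that] nat[OF I, of id] relabel_id[OF p I] by auto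
  next
    fix I and \<sigma> :: "'a \<Rightarrow> 'a" assume "finite I \<and> inj_on \<sigma> I"
    then have I: "finite I" and \<sigma>: "inj_on \<sigma> I" by auto
    let ?g = "inv_into (snd (val p I)) (f I)"
    have J: "finite (\<sigma> ` I)" using I by simp
    have bij: "bij_betw (f I) (snd (val p I)) (snd (val q I))" using species_isomorphismD(2)[OF f I] by simp
    \<comment> \<open>On the carrier this conjugate of \<open>relabel p I \<sigma>\<close> coincides
      with \<open>relabel q I \<sigma>\<close>, and \<open>linear_map\<close> depends only on values
      there.\<close>
    have l: "linear_map (val q I) (val q (\<sigma> ` I)) (\<lambda>y. f (\<sigma> ` I) (relabel p I \<sigma> (?g y)))"
      by (rule linear_map_comp[OF linear_map_comp[OF linear_map_inv_into[OF vp[OF I] lin[OF I] bij] relabel_linear[OF p I \<sigma>]] lin[OF J]])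
    have "f (\<sigma> ` I) (relabel p I \<sigma> (?g y)) = relabel q I \<sigma> y" if "y \<in> obj q I" for y
      using ex[OF I that] nat[OF I \<sigma>] bij by (auto simp: bij_betw_def)
    with l show "linear_map (val q I) (val q (\<sigma> ` I)) (relabel q I \<sigma>)"
      using is_vsp_closed[OF vsp_familyD[OF v I]] by (simp add: linear_map_def)
  next
    fix I and \<sigma> \<tau> :: "'a \<Rightarrow> 'a" and y
    assume "finite I \<and> inj_on \<sigma> I \<and> (\<forall>i\<in>I. \<sigma> i = \<tau> i)" and y: "y \<in> obj q I"
    then have a: "finite I" "inj_on \<sigma> I" "\<forall>i\<in>I. \<sigma> i = \<tau> i" by auto
    then have b: "inj_on \<tau> I" "\<tau> ` I = \<sigma> ` I" by (auto simp: inj_on_def)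
    obtain x where x: "x \<in> obj p I" "y = f I x" using ex[OF a(1) y] by auto
    have "relabel p I \<sigma> x = relabel p I \<tau> x"
      by (rule relabel_cong[OF p a(1,2) _ x(1)]) (use a(3) in blast)
    then show "relabel q I \<sigma> y = relabel q I \<tau> y"
      using nat[OF a(1,2) x(1)] nat[OF a(1) b(1) x(1)] unfolding b(2) x(2) by metis
  next
    fix I and \<sigma> \<tau> :: "'a \<Rightarrow> 'a" and y
    assume "finite I \<and> inj_on \<sigma> I \<and> inj_on \<tau> (\<sigma> ` I)" and y: "y \<in> obj q I"
    then have a: "finite I" "inj_on \<sigma> I" "inj_on \<tau> (\<sigma> ` I)" "finite (\<sigma> ` I)" "inj_on (\<tau> \<circ> \<sigma>) I"
      by (auto intro: comp_inj_on)
    obtain x where x: "x \<in> obj p I" "y = f I x" using ex[OF a(1) y] by auto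
    show "relabel q I (\<tau> \<circ> \<sigma>) y = relabel q (\<sigma> ` I) \<tau> (relabel q I \<sigma> y)"
      using nat[OF a(1,2) x(1)] nat[OF a(1,5) x(1)] nat[OF a(4,3) relabel_in[OF p a(1,2) x(1)]]
        relabel_comp[OF p a(1-3) x(1)] x(2) by (simp add: image_comp)
  qed
qed

text \<open>Cofree coactions are a coproduct followed by the associator; \<open>id \<cdot> f\<close>
  commutes with the first because it acts on the other factor, and with the second by
  \<open>cauchy_assoc_natural\<close>.\<close>

lemma cofree_coaction_natural:
  assumes k: "vsp_family k" "linear_family k (cauchy k k) (comul k)"
    and m: "vsp_family m" and f: "linear_family m n f"
    and I: "finite I" and t: "t \<in> obj (cauchy k m) I"
  shows "cofree_coaction k n I (cauchy_map k n idm f I t) =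
         cauchy_map k (cauchy k n) idm (cauchy_map k n idm f) I (cofree_coaction k m I t)"
proof -
  note idm = linear_family_idm
  \<comment> \<open>Inserting \<open>id \<cdot> id\<close> after the coproduct produces the shape
    \<open>(f \<cdot> g) \<cdot> e\<close> that \<open>cauchy_assoc_natural\<close> demands.\<close>
  have *: "cauchy_map k k idm idm S u = u" if "u \<in> obj (cauchy k k) S" for S u
    unfolding cauchy_map_def using tensor_map_ident[OF cauchy_component[OF that]] cauchy_outside[OF that]
    by (intro ext) (simp split: if_splits)
  have ct: "cauchy_map (cauchy k k) m (comul k) idm I t \<in> obj (cauchy (cauchy k k) m) I"
    using linear_mapD(1)[OF linear_familyD[OF linear_family_cauchy_map[OF k(2) idm] I]] t by simp
  have "cauchy_map (cauchy k k) n (comul k) idm I (cauchy_map k n idm f I t) =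
        cauchy_map (cauchy k k) n (comul k) f I t"
    by (simp add: cauchy_map_comp[OF k(2) idm I])
  also have "\<dots> = cauchy_map (cauchy k k) n (\<lambda>S x. cauchy_map k k idm idm S (comul k S x)) f I t"
  proof (rule cauchy_map_cong[OF k(1) m I t _ refl])
    fix S x assume "S \<subseteq> I" "x \<in> obj k S"
    then have "comul k S x \<in> obj (cauchy k k) S"
      using linear_mapD(1)[OF linear_familyD[OF k(2) finite_subset[OF _ I]]] by simp
    then show "comul k S x = cauchy_map k k idm idm S (comul k S x)" by (simp only: *)
  qed
  also have "\<dots> = cauchy_map (cauchy k k) n (cauchy_map k k idm idm) f I (cauchy_map (cauchy k k) m (comul k) idm I t)"
    by (simp add: cauchy_map_comp[OF linear_family_cauchy_map[OF idm idm] f I])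
  finally show ?thesis
    unfolding cofree_coaction_def by (simp add: cauchy_assoc_natural[OF k(1) k(1) m k(1) k(1) idm idm f I ct])
qed

lemma comonoid_families:
  assumes "is_comonoid k"
  shows "is_species k" "species_morphism k (cauchy k k) (comul k)" "species_morphism k unit_species (counit k)"
    "vsp_family k" "linear_family k (cauchy k k) (comul k)" "linear_family k unit_species (counit k)"
  using assms species_morphism_linear_family is_species_vsp_family by (auto simp: is_comonoid_def)

text \<open>Since \<open>\<phi>\<close> is bijective, the relation between \<open>\<eta>\<close> and
  \<open>\<delta>\<close> determines \<open>\<eta>\<close> on all of \<open>n\<close>.
  Coassociativity is then carried over from \<open>m\<close> by
  \<open>cofree_coaction_natural\<close>, and the counit law by composing factorwise.\<close>

lemma left_comodule_transfer:
  fixes m :: "('a::infinite, 'f::field_char_0, 'v::ab_group_add, 'y) species_scheme"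
    and n :: "('a, 'f, 'w::ab_group_add, 'z) species_scheme"
  assumes k: "is_comonoid k" and m: "left_comodule k m \<delta>" and n: "is_species n"
    and \<phi>: "species_isomorphism m n \<phi>"
    and \<eta>: "\<And>I x. finite I \<Longrightarrow> x \<in> obj m I \<Longrightarrow> \<eta> I (\<phi> I x) = cauchy_map k n idm \<phi> I (\<delta> I x)"
  shows "left_comodule k n \<eta>"
proof -
  note idm = linear_family_idm and K = comonoid_families[OF k]
  have sm: "is_species m" and \<delta>: "species_morphism m (cauchy k m) \<delta>" using m by (auto simp: left_comodule_def)
  note \<phi>m = species_isomorphismD(1)[OF \<phi>]
  note \<phi>l = species_morphism_linear_family[OF \<phi>m] and \<delta>l = species_morphism_linear_family[OF \<delta>]
  note vm = is_species_vsp_family[OF sm] and vn = is_species_vsp_family[OF n]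
  have ex: "\<exists>x\<in>obj m I. y = \<phi> I x" if "finite I" "y \<in> obj n I" for y I
    using species_isomorphismD(2)[OF \<phi> that(1)] that(2) by (auto simp: bij_betw_def)
  have \<phi>in: "\<phi> I x \<in> obj n I" if "finite I" "x \<in> obj m I" for I x
    using linear_mapD(1)[OF linear_familyD[OF \<phi>l]] that by simp
  have \<delta>in: "\<delta> I x \<in> obj (cauchy k m) I" if "finite I" "x \<in> obj m I" for I x
    using linear_mapD(1)[OF linear_familyD[OF \<delta>l]] that by simp
  note comp = species_morphism_comp[OF \<delta> species_morphism_cauchy_map[OF K(1) sm K(1) n species_morphism_idm \<phi>m]]
  have \<eta>m: "species_morphism n (cauchy k n) \<eta>"
    unfolding species_morphism_def
  proof (intro conjI allI impI ballI)
    fix I :: "'a set" assume I: "finite I"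
    let ?g = "inv_into (snd (val m I)) (\<phi> I)"
    have bij: "bij_betw (\<phi> I) (snd (val m I)) (snd (val n I))" using species_isomorphismD(2)[OF \<phi> I] by simp
    have l: "linear_map (val n I) (val (cauchy k n) I) (\<lambda>y. cauchy_map k n idm \<phi> I (\<delta> I (?g y)))"
      by (rule linear_map_comp[OF linear_map_inv_into[OF vsp_familyD[OF vm I] linear_familyD[OF \<phi>l I] bij]
            linear_familyD[OF species_morphism_linear_family[OF comp] I]])
    have "cauchy_map k n idm \<phi> I (\<delta> I (?g y)) = \<eta> I y" if "y \<in> obj n I" for y
      using ex[OF I that] \<eta>[OF I] bij by (auto simp: bij_betw_def)
    with l show "linear_map (val n I) (val (cauchy k n) I) (\<eta> I)"
      using is_vsp_closed[OF vsp_familyD[OF vn I]] by (simp add: linear_map_def)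
  next
    fix I and \<sigma> :: "'a \<Rightarrow> 'a" and y assume "finite I \<and> inj_on \<sigma> I" and y: "y \<in> obj n I"
    then have I: "finite I" and \<sigma>: "inj_on \<sigma> I" by auto
    obtain x where x: "x \<in> obj m I" "y = \<phi> I x" using ex[OF I y] by auto
    have J: "finite (\<sigma> ` I)" using I by simp
    show "\<eta> (\<sigma> ` I) (relabel n I \<sigma> y) = relabel (cauchy k n) I \<sigma> (\<eta> I y)"
      using species_morphism_relabel[OF \<phi>m I \<sigma> x(1)] species_morphism_relabel[OF comp I \<sigma> x(1)]
        \<eta>[OF I x(1)] \<eta>[OF J relabel_in[OF sm I \<sigma> x(1)]] x(2) by simp
  qed
  note \<eta>l = species_morphism_linear_family[OF \<eta>m]
  show ?thesis unfolding left_comodule_def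
  proof (intro conjI allI impI ballI n \<eta>m)
    fix I y assume I: "finite I" and y: "y \<in> obj n I"
    obtain x where x: "x \<in> obj m I" "y = \<phi> I x" using ex[OF I y] by auto
    note \<delta>x = \<delta>in[OF I x(1)]
    have "cauchy_assoc k k n I (cauchy_map (cauchy k k) n (comul k) idm I (\<eta> I y)) =
          cofree_coaction k n I (cauchy_map k n idm \<phi> I (\<delta> I x))"
      by (simp add: x \<eta> I cofree_coaction_def)
    also have "\<dots> = cauchy_map k (cauchy k n) idm (cauchy_map k n idm \<phi>) I (cofree_coaction k m I (\<delta> I x))"
      by (rule cofree_coaction_natural[OF K(4,5) vm \<phi>l I \<delta>x])
    also have "cofree_coaction k m I (\<delta> I x) = cauchy_map k (cauchy k m) idm \<delta> I (\<delta> I x)"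
      using m I x(1) by (simp add: left_comodule_def cofree_coaction_def)
    also have "cauchy_map k (cauchy k n) idm (cauchy_map k n idm \<phi>) I (cauchy_map k (cauchy k m) idm \<delta> I (\<delta> I x)) =
          cauchy_map k (cauchy k n) idm (\<lambda>S x. cauchy_map k n idm \<phi> S (\<delta> S x)) I (\<delta> I x)"
      by (rule cauchy_map_comp[OF idm linear_family_cauchy_map[OF idm \<phi>l] I])
    also have "\<dots> = cauchy_map k (cauchy k n) idm (\<lambda>S x. \<eta> S (\<phi> S x)) I (\<delta> I x)"
      by (rule cauchy_map_cong[OF K(4) vm I \<delta>x]) (simp_all add: \<eta> finite_subset[OF _ I])
    also have "\<dots> = cauchy_map k (cauchy k n) idm \<eta> I (cauchy_map k n idm \<phi> I (\<delta> I x))"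
      by (rule cauchy_map_comp[OF idm \<eta>l I, symmetric])
    also have "\<dots> = cauchy_map k (cauchy k n) idm \<eta> I (\<eta> I y)"
      by (simp add: x \<eta> I)
    finally show "cauchy_assoc k k n I (cauchy_map (cauchy k k) n (comul k) idm I (\<eta> I y)) =
          cauchy_map k (cauchy k n) idm \<eta> I (\<eta> I y)" .
    have "cauchy_map unit_species n (counit k) idm I (\<eta> I y) = cauchy_map unit_species n (counit k) \<phi> I (\<delta> I x)"
      by (simp add: x \<eta> I cauchy_map_comp[OF K(6) idm I])
    also have "\<dots> = cauchy_map unit_species n idm \<phi> I (cauchy_map unit_species m (counit k) idm I (\<delta> I x))"
      by (simp add: cauchy_map_comp[OF idm \<phi>l I])
    also have "\<dots> = cauchy_map unit_species n idm \<phi> ({} \<union> I) (pure_cauchy unit_species m {} I 1 x)"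
      using m I x(1) by (simp add: left_comodule_def unit_left_def)
    also have "\<dots> = unit_left n I y"
      by (subst cauchy_map_pure[OF idm \<phi>l _ I]) (auto simp: unit_species_def unit_left_def x)
    finally show "cauchy_map unit_species n (counit k) idm I (\<eta> I y) = unit_left n I y" .
  qed
qed

section \<open>Products and coproducts in connected bimonoids\<close>

text \<open>The nested evaluation occurring in \<open>cauchy_interchange\<close>: the inner tensor
  varies with the parameters of the outer one.\<close>

lemma bilinear_form_tensor_nested:
  assumes v: "is_vsp V" "is_vsp W"
    and K: "\<And>x y. x \<in> snd V \<Longrightarrow> y \<in> snd W \<Longrightarrow> bilinear_form V' W' (K x y)"
      "\<And>x' y'. x' \<in> snd V' \<Longrightarrow> y' \<in> snd W' \<Longrightarrow> bilinear_form V W (\<lambda>x y. K x y x' y')"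
  shows "bilinear_form (tensor_product V W) (tensor_product V' W') (\<lambda>u w. u (\<lambda>x y. w (K x y)))"
proof (rule bilinear_form_tensor_eval[OF v])
  show "bilinear_form V W (\<lambda>x y. w (K x y))" if "w \<in> snd (tensor_product V' W')" for w
    by (rule bilinear_form_tensor_apply[OF v that K])
qed (auto intro!: linear_mapI simp: tensor_scale_def)

text \<open>The component \<open>h[S] \<otimes> h[T] \<rightarrow> h[S \<squnion> T]\<close> of the
  multiplication, evaluated on elements.\<close>

definition set_prod ::
    "('a, 'f::field, 'v::ab_group_add, 'z) hopf_scheme \<Rightarrow> 'a set \<Rightarrow> 'a set \<Rightarrow> 'v \<Rightarrow> 'v \<Rightarrow> 'v" where
  "set_prod h S T x y = mul h (S \<union> T) (pure_cauchy h h S T x y)"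

lemma bilinear_set_prod:
  assumes "is_monoid h" "finite S" "finite T" "S \<inter> T = {}" "I = S \<union> T"
  shows "bilinear_map (val h S) (val h T) (val h I) (set_prod h S T)"
proof -
  have "linear_map (val (cauchy h h) I) (val h I) (mul h I)"
    using assms by (simp add: is_monoid_def species_morphism_def)
  from bilinear_map_linear_comp[OF bilinear_map_pure_cauchy[OF assms(4,5)] this]
  show ?thesis by (simp add: set_prod_def[abs_def] assms(5))
qed

lemma pure_cauchy_in:
  "S \<inter> T = {} \<Longrightarrow> x \<in> obj p S \<Longrightarrow> y \<in> obj q T \<Longrightarrow> pure_cauchy p q S T x y \<in> obj (cauchy p q) (S \<union> T)"
  using bilinear_mapD(1)[OF bilinear_map_pure_cauchy[OF _ refl]] by fastforce

text \<open>The bimonoid axiom in components: to cut the product \<open>b x\<close> along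
  \<open>S'\<close>, cut \<open>b\<close> at \<open>S \<inter> S'\<close> and \<open>x\<close> at
  \<open>S' - S\<close>, then multiply the first parts and the second parts.\<close>

lemma comul_set_prod:
  assumes h: "is_bimonoid h" and fin: "finite S" "finite T" and disj: "S \<inter> T = {}"
    and b: "b \<in> obj h S" and x: "x \<in> obj h T" and S': "S' \<subseteq> S \<union> T"
    and B: "bilinear_form (val h S') (val h (S \<union> T - S')) B"
  shows "comul h (S \<union> T) (set_prod h S T b x) S' B =
    comul h S b (S \<inter> S') (\<lambda>b1 b2. comul h T x (S' - S) (\<lambda>x1 x2.
      B (set_prod h (S \<inter> S') (S' - S) b1 x1) (set_prod h (S - S') (T - S') b2 x2)))"
proof -
  define A where "A = S \<inter> S'"
  define C where "C = S - S'"
  define D where "D = S' - S"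
  define E where "E = T - S'"
  note defs = A_def C_def D_def E_def
  let ?I = "S \<union> T"
  have e: "S - A = C" "T - D = E" "?I - S - S' = E" "A \<union> D = S'" "C \<union> E = ?I - S'" "A \<subseteq> S" "D \<subseteq> T"
    "A \<inter> D = {}" "C \<inter> E = {}" using disj S' by (auto simp: defs)
  have f: "finite A" "finite C" "finite D" "finite E" "finite ?I" "finite S'" "finite (?I - S')"
    using fin S' finite_subset[of S' ?I] by (auto simp: defs)
  have mon: "is_monoid h" and com: "is_comonoid h" using h by (auto simp: is_bimonoid_def)
  note H = comonoid_families[OF com]
  have ml: "linear_family (cauchy h h) h (mul h)"
    using mon species_morphism_linear_family by (auto simp: is_monoid_def)
  \<comment> \<open>Evaluating the right-hand side of the bimonoid axiom at \<open>B\<close> means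
    evaluating the interchange at this pullback.\<close>
  define M where "M u v = B (mul h S' u) (mul h (?I - S') v)" for u v
  have M: "bilinear_form (val (cauchy h h) S') (val (cauchy h h) (?I - S')) M"
    unfolding M_def by (rule bilinear_map_comp[OF B linear_familyD[OF ml f(6)] linear_familyD[OF ml f(7)]])
  \<comment> \<open>The form that \<open>cauchy_interchange\<close> builds from \<open>M\<close> in
    the summand with index \<open>S\<close>.\<close>
  define K where "K b1 b2 = (\<lambda>x1 x2. M (pure_cauchy h h A D b1 x1) (pure_cauchy h h C E b2 x2))" for b1 b2
  note pL = bilinear_map_pure_cauchy[OF e(8) e(4)[symmetric], of h h]
  note pR = bilinear_map_pure_cauchy[OF e(9) e(5)[symmetric], of h h]
  have K1: "bilinear_form (val h D) (val h E) (K b1 b2)" if "b1 \<in> snd (val h A)" "b2 \<in> snd (val h C)" for b1 b2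
    unfolding K_def
    by (rule bilinear_map_comp[OF M bilinear_map_linear_right[OF pL that(1)] bilinear_map_linear_right[OF pR that(2)]])
  have K2: "bilinear_form (val h A) (val h C) (\<lambda>b1 b2. K b1 b2 x1 x2)" if "x1 \<in> snd (val h D)" "x2 \<in> snd (val h E)" for x1 x2
    unfolding K_def
    by (rule bilinear_map_comp[OF M bilinear_map_linear_left[OF pL that(1)] bilinear_map_linear_left[OF pR that(2)]])
  have G: "bilinear_form (val (cauchy h h) S) (val (cauchy h h) T) (\<lambda>u w. u A (\<lambda>b1 b2. w D (K b1 b2)))"
    by (rule bilinear_map_comp[OF bilinear_form_tensor_nested[OF vsp_familyD[OF H(4) f(1)] vsp_familyD[OF H(4) f(2)] K1 K2]
          linear_map_cauchy_component[OF e(6), of h h, unfolded e(1)]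
          linear_map_cauchy_component[OF e(7), of h h, unfolded e(2)]])
  let ?t = "pure_cauchy h h S T b x"
  let ?t' = "pure_cauchy (cauchy h h) (cauchy h h) S T (comul h S b) (comul h T x)"
  have "comul h ?I (set_prod h S T b x) = cauchy_map h h (mul h) (mul h) ?I
             (cauchy_interchange h h h h ?I (cauchy_map (cauchy h h) (cauchy h h) (comul h) (comul h) ?I ?t))"
    using h f(5) pure_cauchy_in[OF disj b x] by (simp add: is_bimonoid_def set_prod_def)
  also have "cauchy_map (cauchy h h) (cauchy h h) (comul h) (comul h) ?I ?t = ?t'"
    by (rule cauchy_map_pure[OF H(5) H(5) fin disj b x])
  finally have "comul h ?I (set_prod h S T b x) S' B = cauchy_interchange h h h h ?I ?t' S' M"
    using S' B by (simp add: cauchy_map_def tensor_map_def M_def[abs_def])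
  also have "\<dots> = (\<Sum>U | U \<subseteq> ?I. ?t' U (\<lambda>u w. u (U \<inter> S') (\<lambda>x y. w (S' - U) (\<lambda>x' y'.
                      M (pure_cauchy h h (U \<inter> S') (S' - U) x x')
                        (pure_cauchy h h (U - S') (?I - U - S') y y')))))"
    using S' M by (simp add: cauchy_interchange_def)
  \<comment> \<open>The tensor \<open>?t'\<close> is concentrated at the index \<open>S\<close>, so
    all other summands vanish.\<close>
  also have "\<dots> = (\<Sum>U | U \<subseteq> ?I. if U = S then ?t' S (\<lambda>u w. u A (\<lambda>b1 b2. w D (K b1 b2))) else 0)"
    by (rule sum.cong) (auto simp: e(3)[unfolded E_def] K_def defs pure_cauchy_def[of "cauchy h h"] summand_def)
  also have "\<dots> = ?t' S (\<lambda>u w. u A (\<lambda>b1 b2. w D (K b1 b2)))"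
    using f(5) by (subst sum.delta) auto
  also have "\<dots> = comul h S b A (\<lambda>b1 b2. comul h T x D (K b1 b2))"
    using G by (simp add: pure_cauchy_def[of "cauchy h h"] summand_def pure_tensor_def)
  also have "K = (\<lambda>b1 b2 x1 x2. B (set_prod h A D b1 x1) (set_prod h C E b2 x2))"
    by (simp add: K_def M_def set_prod_def e fun_eq_iff)
  finally show ?thesis by (simp add: defs)
qed

section \<open>Unit laws and consequences of connectedness\<close>

lemma set_prod_unit_left:
  assumes "is_monoid h" "finite I" "x \<in> obj h I"
  shows "set_prod h {} I (unt h {} 1) x = x"
proof -
  have "linear_family unit_species h (unt h)"
    using assms species_morphism_linear_family by (auto simp: is_monoid_def)
  from cauchy_map_pure[OF this linear_family_idm, of "{}" I 1 x h] assms(2,3)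
  have "cauchy_map h h (unt h) idm I (unit_left h I x) = pure_cauchy h h {} I (unt h {} 1) x"
    by (simp add: unit_left_def unit_species_def)
  moreover have "mul h I (cauchy_map h h (unt h) idm I (unit_left h I x)) = x"
    using assms by (simp add: is_monoid_def)
  ultimately show ?thesis by (simp add: set_prod_def)
qed

lemma set_prod_unit_right:
  assumes "is_monoid h" "finite I" "x \<in> obj h I"
  shows "set_prod h I {} x (unt h {} 1) = x"
proof -
  have "linear_family unit_species h (unt h)"
    using assms species_morphism_linear_family by (auto simp: is_monoid_def)
  from cauchy_map_pure[OF linear_family_idm this, of I "{}" x h 1] assms(2,3)
  have "cauchy_map h h idm (unt h) I (unit_right h I x) = pure_cauchy h h I {} x (unt h {} 1)"
    by (simp add: unit_right_def unit_species_def)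
  moreover have "mul h I (cauchy_map h h idm (unt h) I (unit_right h I x)) = x"
    using assms by (simp add: is_monoid_def)
  ultimately show ?thesis by (simp add: set_prod_def)
qed

lemma bimonoid_unit:
  fixes h :: "('a::infinite, 'f::field_char_0, 'v::ab_group_add, 'z) hopf_scheme"
  assumes "is_bimonoid h"
  shows "unt h {} 1 \<in> obj h {}" "counit h {} (unt h {} 1) = 1"
proof -
  have "linear_map (val (unit_species :: ('a, 'f, 'f) species) {}) (val h {}) (unt h {})"
    using assms linear_familyD[OF species_morphism_linear_family]
    by (auto simp: is_bimonoid_def is_monoid_def)
  from linear_mapD(1)[OF this] show "unt h {} 1 \<in> obj h {}" by (simp add: unit_species_def)
  show "counit h {} (unt h {} 1) = 1" using assms by (simp add: is_bimonoid_def unit_species_def)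
qed

text \<open>The space \<open>h[\<emptyset>]\<close> is a line and the unit is a nonzero point of it
  because its counit is 1; so the counit reads off the coordinate.\<close>

lemma connected_empty:
  assumes h: "is_bimonoid h" and conn: "connected_species h" and z: "z \<in> obj h {}"
  shows "z = scl h (counit h {} z) (unt h {} 1)"
proof -
  have com: "is_comonoid h" using h by (simp add: is_bimonoid_def)
  note H = comonoid_families[OF com]
  interpret vector_space "scl h" using vsp_familyD[OF H(4), of "{}"] by (simp add: is_vsp_def)
  note \<epsilon> = linear_mapD[OF linear_familyD[OF H(6), of "{}"], unfolded snd_conv fst_conv, OF finite.emptyI]
  have scl_unit: "scl unit_species c d = c * d" for c d :: 'b by (simp add: unit_species_def)
  let ?e = "unt h {} 1"
  note e = bimonoid_unit[OF h]
  obtain B where B: "B \<subseteq> obj h {}" "obj h {} \<subseteq> span B" "card B = dim (obj h {})" using basis_exists by metis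
  have "card B = 1" using B(3) conn by (simp add: connected_species_def)
  then obtain u where u: "B = {u}" using card_1_singletonE by blast
  have uh: "u \<in> obj h {}" using B u by simp
  have mult: "\<exists>c. y = scl h c u" if "y \<in> obj h {}" for y
    using that B(2) u by (auto simp: span_singleton)
  obtain c where c: "?e = scl h c u" using mult[OF e(1)] by auto
  obtain d where d: "z = scl h d u" using mult[OF z] by auto
  have "c * counit h {} u = 1" using e(2) \<epsilon>(3)[OF uh, of c] by (simp add: c scl_unit)
  \<comment> \<open>With \<open>u\<close> the basis vector, \<open>c\<close> and the counit of
    \<open>u\<close> are inverse to each other; this exchanges the coordinate along \<open>u\<close>
    for the one along the unit.\<close>
  then have "d = d * counit h {} u * c" by (simp add: mult.commute mult.left_commute)
  also have "d * counit h {} u = counit h {} z" using \<epsilon>(3)[OF uh, of d] by (simp add: d scl_unit)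
  finally show ?thesis by (metis c d scale_scale)
qed

text \<open>The component of \<open>\<Delta>(x)\<close> over the empty set is
  \<open>e \<otimes> x\<close>: the counit law fixes it up to the identification of
  \<open>h[\<emptyset>]\<close> with the field, which \<open>e\<close> provides.\<close>

lemma comul_empty_left:
  fixes h :: "('a::infinite, 'f::field_char_0, 'v::ab_group_add, 'z) hopf_scheme"
  assumes h: "is_comonoid h" and I: "finite I" and x: "x \<in> obj h I"
    and e: "e \<in> obj h {}" "\<And>z. z \<in> obj h {} \<Longrightarrow> z = scl h (counit h {} z) e"
    and C: "bilinear_form (val h {}) (val h I) C"
  shows "comul h I x {} C = C e x"
proof -
  note H = comonoid_families[OF h]
  have Dx: "comul h I x {} \<in> snd (tensor_product (val h {}) (val h I))"
    using cauchy_component[of "comul h I x" h h I "{}"] linear_mapD(1)[OF linear_familyD[OF H(5) I]] x by simp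
  \<comment> \<open>A form whose pullback along the counit agrees with \<open>C\<close> on the
    carriers, so that the counit law can be evaluated at it.\<close>
  have D: "bilinear_form (val (unit_species :: ('a, 'f, 'f) species) {}) (val h I) (\<lambda>c y. c * C e y)"
    using bilinear_mapD[OF C] e(1) by (intro bilinear_mapI) (simp_all add: unit_species_def algebra_simps)
  have "comul h I x {} C = comul h I x {} (\<lambda>z y. counit h {} z * C e y)"
  proof (rule tensor_apply_cong[OF vsp_familyD[OF H(4)] vsp_familyD[OF H(4) I] Dx])
    fix z y assume "z \<in> snd (val h {})" "y \<in> snd (val h I)"
    then show "C z y = counit h {} z * C e y"
      using bilinear_mapD(4)[OF C, of e y "counit h {} z"] e by simp
  qed simp
  also have "\<dots> = cauchy_map unit_species h (counit h) idm I (comul h I x) {} (\<lambda>c y. c * C e y)"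
    using D by (simp add: cauchy_map_def tensor_map_def)
  also have "\<dots> = unit_left h I x {} (\<lambda>c y. c * C e y)"
    using h I x by (simp add: is_comonoid_def)
  also have "\<dots> = C e x"
    using D by (simp add: unit_left_def pure_cauchy_def summand_def pure_tensor_def)
  finally show ?thesis .
qed

text \<open>The mirror image, from the other counit law: the component over the full set is
  \<open>x \<otimes> e\<close>.\<close>

lemma comul_empty_right:
  fixes h :: "('a::infinite, 'f::field_char_0, 'v::ab_group_add, 'z) hopf_scheme"
  assumes h: "is_comonoid h" and I: "finite I" and x: "x \<in> obj h I"
    and e: "e \<in> obj h {}" "\<And>z. z \<in> obj h {} \<Longrightarrow> z = scl h (counit h {} z) e"
    and C: "bilinear_form (val h I) (val h {}) C"
  shows "comul h I x I C = C x e"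
proof -
  note H = comonoid_families[OF h]
  have Dx: "comul h I x I \<in> snd (tensor_product (val h I) (val h {}))"
    using cauchy_component[of "comul h I x" h h I I] linear_mapD(1)[OF linear_familyD[OF H(5) I]] x by simp
  have D: "bilinear_form (val h I) (val (unit_species :: ('a, 'f, 'f) species) {}) (\<lambda>y c. c * C y e)"
    using bilinear_mapD[OF C] e(1) by (intro bilinear_mapI) (simp_all add: unit_species_def algebra_simps)
  have "comul h I x I C = comul h I x I (\<lambda>y z. counit h {} z * C y e)"
  proof (rule tensor_apply_cong[OF vsp_familyD[OF H(4) I] vsp_familyD[OF H(4)] Dx])
    fix y z assume "y \<in> snd (val h I)" "z \<in> snd (val h {})"
    then show "C y z = counit h {} z * C y e"
      using bilinear_mapD(5)[OF C, of y e "counit h {} z"] e by simp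
  qed simp
  also have "\<dots> = cauchy_map h unit_species idm (counit h) I (comul h I x) I (\<lambda>y c. c * C y e)"
    using D by (simp add: cauchy_map_def tensor_map_def)
  also have "\<dots> = unit_right h I x I (\<lambda>y c. c * C y e)"
    using h I x by (simp add: is_comonoid_def)
  also have "\<dots> = C x e"
    using D by (simp add: unit_right_def pure_cauchy_def summand_def pure_tensor_def)
  finally show ?thesis .
qed

section \<open>The coaction and the Hopf kernel\<close>

locale bimonoid_quotient =
  fixes h :: "('a::infinite, 'f::field_char_0, 'v::ab_group_add) hopf"
    and k :: "('a, 'f, 'w::ab_group_add) hopf"
    and \<pi> :: "'a set \<Rightarrow> 'v \<Rightarrow> 'w"
  assumes h: "is_bimonoid h" and conn: "connected_species h" and k: "is_bimonoid k"
    and \<pi>: "hopf_morphism h k \<pi>" and surj: "surjective_morphism h k \<pi>"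
begin

abbreviation "\<delta> \<equiv> induced_coaction h k \<pi>"
abbreviation "K \<equiv> Hker h k \<pi>"
abbreviation "e \<equiv> unt h {} 1"

lemma monoid_h: "is_monoid h" and comonoid_h: "is_comonoid h"
  and monoid_k: "is_monoid k" and comonoid_k: "is_comonoid k"
  using h k by (auto simp: is_bimonoid_def)

lemmas h_families = comonoid_families[OF comonoid_h]
lemmas k_families = comonoid_families[OF comonoid_k]

lemma \<pi>_morphism: "species_morphism h k \<pi>" using \<pi> by (simp add: hopf_morphism_def)
lemmas \<pi>_linear = species_morphism_linear_family[OF \<pi>_morphism]

lemma comul_in: "finite I \<Longrightarrow> x \<in> obj h I \<Longrightarrow> comul h I x \<in> obj (cauchy h h) I"
  using linear_mapD(1)[OF linear_familyD[OF h_families(5)]] by simp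

lemma coaction_morphism: "species_morphism h (cauchy k h) \<delta>"
  unfolding induced_coaction_def[abs_def]
  by (rule species_morphism_comp[OF h_families(2)
        species_morphism_cauchy_map[OF h_families(1) h_families(1) k_families(1) h_families(1) \<pi>_morphism species_morphism_idm]])

lemmas coaction_linear = species_morphism_linear_family[OF coaction_morphism]

lemma coaction_in: "finite I \<Longrightarrow> x \<in> obj h I \<Longrightarrow> \<delta> I x \<in> obj (cauchy k h) I"
  using linear_mapD(1)[OF linear_familyD[OF coaction_linear]] by simp

text \<open>As \<open>\<pi>\<close> respects coproducts, the left side is
  \<open>\<pi> \<cdot> (\<pi> \<cdot> id)\<close> applied to a reassociated iterated coproduct of
  \<open>h\<close>; naturality of the associator and coassociativity of \<open>\<Delta>\<close> do
  the rest.\<close>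

lemma coaction_coassoc:
  assumes I: "finite I" and x: "x \<in> obj h I"
  shows "cofree_coaction k h I (\<delta> I x) = cauchy_map k (cauchy k h) idm \<delta> I (\<delta> I x)"
proof -
  note idm = linear_family_idm and \<Delta>x = comul_in[OF I x]
  note \<pi>\<pi> = linear_family_cauchy_map[OF \<pi>_linear \<pi>_linear]
  have c: "cauchy_map (cauchy h h) h (comul h) idm I (comul h I x) \<in> obj (cauchy (cauchy h h) h) I"
    using linear_mapD(1)[OF linear_familyD[OF linear_family_cauchy_map[OF h_families(5) idm] I]] \<Delta>x by simp
  have "cauchy_map (cauchy k k) h (comul k) idm I (\<delta> I x) =
        cauchy_map (cauchy k k) h (\<lambda>S x. comul k S (\<pi> S x)) idm I (comul h I x)"
    by (simp add: induced_coaction_def cauchy_map_comp[OF k_families(5) idm I])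
  also have "\<dots> = cauchy_map (cauchy k k) h (\<lambda>S x. cauchy_map k k \<pi> \<pi> S (comul h S x)) idm I (comul h I x)"
    using \<pi> by (intro cauchy_map_cong[OF h_families(4) h_families(4) I \<Delta>x]) (simp_all add: hopf_morphism_def finite_subset[OF _ I])
  also have "\<dots> = cauchy_map (cauchy k k) h (cauchy_map k k \<pi> \<pi>) idm I (cauchy_map (cauchy h h) h (comul h) idm I (comul h I x))"
    by (simp add: cauchy_map_comp[OF \<pi>\<pi> idm I])
  finally have "cofree_coaction k h I (\<delta> I x) = cauchy_map k (cauchy k h) \<pi> (cauchy_map k h \<pi> idm) I
      (cauchy_assoc h h h I (cauchy_map (cauchy h h) h (comul h) idm I (comul h I x)))"
    by (simp add: cofree_coaction_def
        cauchy_assoc_natural[OF h_families(4) h_families(4) h_families(4) k_families(4) k_families(4) \<pi>_linear \<pi>_linear idm I c])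
  also have "cauchy_assoc h h h I (cauchy_map (cauchy h h) h (comul h) idm I (comul h I x)) =
      cauchy_map h (cauchy h h) idm (comul h) I (comul h I x)"
    using comonoid_h I x by (simp add: is_comonoid_def)
  also have "cauchy_map k (cauchy k h) \<pi> (cauchy_map k h \<pi> idm) I \<dots> = cauchy_map k (cauchy k h) \<pi> \<delta> I (comul h I x)"
    by (simp add: cauchy_map_comp[OF \<pi>_linear linear_family_cauchy_map[OF \<pi>_linear idm] I] induced_coaction_def[abs_def])
  also have "\<dots> = cauchy_map k (cauchy k h) idm \<delta> I (\<delta> I x)"
    by (simp add: induced_coaction_def[of h k \<pi> I x] cauchy_map_comp[OF idm coaction_linear I])
  finally show ?thesis .
qed

lemma coaction_comodule: "left_comodule k h \<delta>"
  unfolding left_comodule_def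
proof (intro conjI allI impI ballI h_families(1) coaction_morphism)
  fix I x assume I: "finite I" and x: "x \<in> obj h I"
  note idm = linear_family_idm
  show "cauchy_assoc k k h I (cauchy_map (cauchy k k) h (comul k) idm I (\<delta> I x)) =
        cauchy_map k (cauchy k h) idm \<delta> I (\<delta> I x)"
    using coaction_coassoc[OF I x] by (simp add: cofree_coaction_def)
  have "cauchy_map unit_species h (counit k) idm I (\<delta> I x) =
        cauchy_map unit_species h (\<lambda>S x. counit k S (\<pi> S x)) idm I (comul h I x)"
    by (simp add: induced_coaction_def cauchy_map_comp[OF k_families(6) idm I])
  also have "\<dots> = cauchy_map unit_species h (counit h) idm I (comul h I x)"
    using \<pi> by (intro cauchy_map_cong[OF h_families(4) h_families(4) I comul_in[OF I x]]) (simp_all add: hopf_morphism_def finite_subset[OF _ I])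
  finally show "cauchy_map unit_species h (counit k) idm I (\<delta> I x) = unit_left h I x"
    using comonoid_h I x by (simp add: is_comonoid_def)
qed

text \<open>Passing from \<open>\<pi>\<close> to \<open>\<pi>_+\<close> alters only the component
  over the empty set, which then lies in \<open>{0} \<otimes> h[I]\<close> and imposes no condition.
  The kernel is thus described by the coaction alone.\<close>

lemma Hker_iff:
  assumes I: "finite I"
  shows "x \<in> obj K I \<longleftrightarrow> x \<in> obj h I \<and> (\<forall>S. S \<subseteq> I \<longrightarrow> S \<noteq> {} \<longrightarrow> \<delta> I x S = 0)"
proof -
  let ?c = "\<lambda>x. cauchy_map (positive_part k) h (\<lambda>S y. positive_proj S (\<pi> S y)) idm I (comul h I x)"
  have c: "?c x S = (if S = {} then 0 else \<delta> I x S)" if x: "x \<in> obj h I" for S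
  proof (cases "S = {}")
    case True
    have Dx: "comul h I x {} \<in> snd (tensor_product (val h {}) (val h I))"
      using cauchy_component[OF comul_in[OF I x], of "{}"] by simp
    \<comment> \<open>Over the empty set \<open>positive_proj\<close> sends everything to 0.
      Bilinearity gives \<open>B 0 y = 0\<close> only for \<open>y\<close> in the carrier, hence the
      congruence rule.\<close>
    have "comul h I x {} (\<lambda>x y. B 0 y) = 0" if B: "bilinear_form (scl k, {0}) (val h I) B" for B
    proof -
      have "B 0 y = 0" if "y \<in> obj h I" for y
        using bilinear_mapD(2)[OF B, of 0 0 y] that by simp
      then have "comul h I x {} (\<lambda>x y. B 0 y) = comul h I x {} (\<lambda>x y. 0)"
        by (intro tensor_apply_cong[OF vsp_familyD[OF h_families(4)] vsp_familyD[OF h_families(4) I] Dx]) auto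
      then show ?thesis using tensor_apply_zero[OF Dx] by simp
    qed
    then show ?thesis
      using True by (simp add: cauchy_map_def positive_part_def positive_proj_def tensor_map_def fun_eq_iff)
  next
    case False
    then show ?thesis
      by (simp add: cauchy_map_def positive_part_def positive_proj_def induced_coaction_def)
  qed
  have "?c x = 0 \<longleftrightarrow> (\<forall>S. S \<noteq> {} \<longrightarrow> \<delta> I x S = 0)" if "x \<in> obj h I"
    by (subst fun_eq_iff) (simp add: c[OF that])
  then have "x \<in> obj K I \<longleftrightarrow> x \<in> obj h I \<and> (\<forall>S. S \<noteq> {} \<longrightarrow> \<delta> I x S = 0)"
    by (auto simp: Hker_def)
  also have "\<dots> \<longleftrightarrow> x \<in> obj h I \<and> (\<forall>S. S \<subseteq> I \<longrightarrow> S \<noteq> {} \<longrightarrow> \<delta> I x S = 0)"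
    using cauchy_outside[OF coaction_in[OF I]] by blast
  finally show ?thesis .
qed

section \<open>The Hopf kernel as a subspecies\<close>

lemma Hker_fields [simp]: "scl K = scl h" "relabel K = relabel h"
  by (simp_all add: Hker_def)

lemma Hker_subset: "obj K I \<subseteq> obj h I"
  by (auto simp: Hker_def)

lemma Hker_vsp:
  assumes I: "finite I"
  shows "is_vsp (val K I)"
proof -
  note v = vsp_familyD[OF h_families(4) I] and l = linear_familyD[OF coaction_linear I]
  interpret vector_space "scl h" using v by (simp add: is_vsp_def)
  note cl = is_vsp_closed[OF v, unfolded fst_conv snd_conv] and \<delta> = linear_mapD[OF l, unfolded fst_conv snd_conv]
  have "subspace (obj K I)"
    by (rule subspaceI)
      (auto simp: Hker_iff[OF I] cl \<delta> linear_map_0[OF v l] scl_cauchy tensor_scale_zero)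
  then show ?thesis by (simp add: is_vsp_def vector_space_axioms)
qed

lemma Hker_species: "is_species K"
proof -
  have rin: "relabel h I \<sigma> x \<in> obj K (\<sigma> ` I)" if I: "finite I" "inj_on \<sigma> I" and x: "x \<in> obj K I" for I \<sigma> x
  proof -
    have xh: "x \<in> obj h I" and x0: "\<And>S. S \<subseteq> I \<Longrightarrow> S \<noteq> {} \<Longrightarrow> \<delta> I x S = 0"
      using x by (auto simp: Hker_iff[OF I(1)])
    have "relabel (cauchy k h) I \<sigma> (\<delta> I x) S = 0" if "S \<subseteq> \<sigma> ` I" "S \<noteq> {}" for S
    proof -
      have "{i \<in> I. \<sigma> i \<in> S} \<noteq> {}" using that by blast
      then have "\<delta> I x {i \<in> I. \<sigma> i \<in> S} = 0" by (intro x0) auto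
      then show ?thesis by (simp add: cauchy_def Let_def)
    qed
    then show ?thesis
      using species_morphism_relabel[OF coaction_morphism I xh] relabel_in[OF h_families(1) I xh] I(1)
      by (simp add: Hker_iff)
  qed
  show ?thesis
    unfolding is_species_def Hker_fields
  proof (intro conjI allI impI ballI)
    fix I :: "'a set" assume I: "finite I"
    show "is_vsp (scl h, obj K I)" using Hker_vsp[OF I] by simp
    then show "finite_dim_vsp (scl h, obj K I)"
      by (rule finite_dim_subspace[OF _ _ Hker_subset]) (use h_families(1) I in \<open>simp add: is_species_def\<close>)
    show "relabel h I id x = x" if "x \<in> obj K I" for x
      using relabel_id[OF h_families(1) I] that Hker_subset by blast
  next
    fix I and \<sigma> :: "'a \<Rightarrow> 'a" assume "finite I \<and> inj_on \<sigma> I"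
    then have I: "finite I" "inj_on \<sigma> I" by auto
    show "linear_map (scl h, obj K I) (scl h, obj K (\<sigma> ` I)) (relabel h I \<sigma>)"
      using relabel_linear[OF h_families(1) I] rin[OF I] Hker_subset[of I] by (auto simp: linear_map_def subset_iff)
  next
    fix I and \<sigma> \<tau> :: "'a \<Rightarrow> 'a" and x
    assume a: "finite I \<and> inj_on \<sigma> I \<and> (\<forall>i\<in>I. \<sigma> i = \<tau> i)" and "x \<in> obj K I"
    then have "x \<in> obj h I" using Hker_subset by auto
    then show "relabel h I \<sigma> x = relabel h I \<tau> x"
      by (intro relabel_cong[OF h_families(1)]) (use a in blast)+
  next
    fix I and \<sigma> \<tau> :: "'a \<Rightarrow> 'a" and x
    assume a: "finite I \<and> inj_on \<sigma> I \<and> inj_on \<tau> (\<sigma> ` I)" and "x \<in> obj K I"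
    then have "x \<in> obj h I" using Hker_subset by auto
    then show "relabel h I (\<tau> \<circ> \<sigma>) x = relabel h (\<sigma> ` I) \<tau> (relabel h I \<sigma> x)"
      using relabel_comp[OF h_families(1), of I \<sigma> \<tau> x] a by simp
  qed
qed

lemma Hker_retraction_exists:
  "\<exists>\<rho>. species_morphism h K \<rho> \<and> (\<forall>I. finite I \<longrightarrow> (\<forall>x\<in>obj K I. \<rho> I x = x))"
  by (rule equivariant_retraction_exists[OF h_families(1) Hker_species _ _ Hker_subset]) simp_all

lemma unit_in: "e \<in> obj h {}"
  by (rule bimonoid_unit[OF h])

lemmas empty_eq = connected_empty[OF h conn]

lemma \<pi>_set_prod:
  assumes "finite S" "finite T" "S \<inter> T = {}" "x \<in> obj h S" "y \<in> obj h T"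
  shows "\<pi> (S \<union> T) (set_prod h S T x y) = set_prod k S T (\<pi> S x) (\<pi> T y)"
  using \<pi> assms cauchy_map_pure[OF \<pi>_linear \<pi>_linear assms] pure_cauchy_in[OF assms(3-5)]
  by (simp add: hopf_morphism_def set_prod_def)

end

section \<open>The isomorphism\<close>

lemma sum_fun_apply: "(\<Sum>a\<in>A. g a) s = (\<Sum>a\<in>A. g a s)"
  by (induction A rule: infinite_finite_induct) auto

lemma sum_summand: "finite A \<Longrightarrow> (\<Sum>S\<in>A. summand S (f S)) = (\<lambda>S. if S \<in> A then f S else 0)"
  by (auto simp: sum_fun_apply summand_def sum.delta' fun_eq_iff[of "sum _ _"])

lemma summand_add: "summand S (t + u) = summand S t + summand S u"
  by (auto simp: summand_def fun_eq_iff[of _ "_ + _"])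

lemma summand_scale: "summand S (tensor_scale c t) = scl (cauchy p q) c (summand S t)"
  by (auto simp: summand_def scl_cauchy tensor_scale_zero fun_eq_iff[of _ "scl _ _ _"])

lemma summand_zero: "summand S 0 = 0"
  by (auto simp: summand_def fun_eq_iff[of _ 0])

context bimonoid_quotient
begin

context
  fixes \<rho> :: "'a set \<Rightarrow> 'v \<Rightarrow> 'v"
  assumes \<rho>: "species_morphism h K \<rho>"
    and \<rho>_id: "\<And>I x. finite I \<Longrightarrow> x \<in> obj K I \<Longrightarrow> \<rho> I x = x"
begin

definition \<phi> :: "'a set \<Rightarrow> 'v \<Rightarrow> ('a, 'f, 'w, 'v) cauchy" where
  "\<phi> I x = cauchy_map k K idm \<rho> I (\<delta> I x)"

lemma \<phi>_morphism: "species_morphism h (cauchy k K) \<phi>"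
  unfolding \<phi>_def[abs_def]
  by (rule species_morphism_comp[OF coaction_morphism
        species_morphism_cauchy_map[OF k_families(1) h_families(1) k_families(1) Hker_species species_morphism_idm \<rho>]])

lemmas \<phi>_linear = species_morphism_linear_family[OF \<phi>_morphism]
lemmas \<rho>_linear = species_morphism_linear_family[OF \<rho>]

lemma \<phi>_apply:
  assumes "finite I" "S \<subseteq> I" "bilinear_form (val k S) (val K (I - S)) B"
  shows "\<phi> I x S B = comul h I x S (\<lambda>a y. B (\<pi> S a) (\<rho> (I - S) y))"
  using assms
  by (simp add: \<phi>_def induced_coaction_def cauchy_map_comp[OF linear_family_idm \<rho>_linear])
    (simp add: cauchy_map_def tensor_map_def)

text \<open>The universal property of the cofree comodule: \<open>id \<cdot> \<rho>\<close> passes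
  through cofree coactions by naturality, and \<open>\<delta>\<close> is coassociative.\<close>

lemma \<phi>_coaction:
  assumes I: "finite I" and x: "x \<in> obj h I"
  shows "cofree_coaction k K I (\<phi> I x) = cauchy_map k (cauchy k K) idm \<phi> I (\<delta> I x)"
proof -
  note idm = linear_family_idm
  have "cofree_coaction k K I (\<phi> I x) =
        cauchy_map k (cauchy k K) idm (cauchy_map k K idm \<rho>) I (cofree_coaction k h I (\<delta> I x))"
    unfolding \<phi>_def by (rule cofree_coaction_natural[OF k_families(4,5) h_families(4) \<rho>_linear I coaction_in[OF I x]])
  also have "\<dots> = cauchy_map k (cauchy k K) idm \<phi> I (\<delta> I x)"
    by (simp add: coaction_coassoc[OF I x] cauchy_map_comp[OF idm linear_family_cauchy_map[OF idm \<rho>_linear] I] \<phi>_def[abs_def])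
  finally show ?thesis .
qed

text \<open>If \<open>S'\<close> leaves \<open>S\<close>, then \<open>S' - S\<close> is a nonempty
  part of \<open>T\<close>, and cutting \<open>b x\<close> along \<open>S'\<close> involves the
  component of \<open>\<delta>(x)\<close> at \<open>S' - S\<close>. This is 0 since \<open>x\<close>
  lies in the Hopf kernel.\<close>

lemma \<phi>_set_prod_outside:
  assumes fin: "finite S" "finite T" and disj: "S \<inter> T = {}"
    and b: "b \<in> obj h S" and x: "x \<in> obj K T" and S': "\<not> S' \<subseteq> S"
  shows "\<phi> (S \<union> T) (set_prod h S T b x) S' = 0"
proof (cases "S' \<subseteq> S \<union> T")
  case False
  then show ?thesis by (simp add: \<phi>_def cauchy_map_def)
next
  case True
  show ?thesis
  proof
    fix B
    show "\<phi> (S \<union> T) (set_prod h S T b x) S' B = 0 B"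
    proof (cases "bilinear_form (val k S') (val K (S \<union> T - S')) B")
      case False
      then show ?thesis using True by (simp add: \<phi>_def cauchy_map_def tensor_map_def)
    next
      case B: True
      have xh: "x \<in> obj h T" using x Hker_subset by auto
      have f: "finite (S \<union> T)" "finite S'" "finite (S \<union> T - S')" "finite (S \<inter> S')" "finite (S' - S)"
        "finite (S - S')" "finite (T - S')"
        using fin True finite_subset[of S' "S \<union> T"] by auto
      have sets: "S \<inter> S' \<union> (S' - S) = S'" "S - S' \<union> (T - S') = S \<union> T - S'" "S \<inter> S' \<inter> (S' - S) = {}"
        "(S - S') \<inter> (T - S') = {}" "S' - S \<subseteq> T" "S' - S \<noteq> {}" "T - (S' - S) = T - S'" "S - S \<inter> S' = S - S'"
        using S' True disj by auto
      note B' = bilinear_map_comp[OF B linear_familyD[OF \<pi>_linear f(2)] linear_familyD[OF \<rho>_linear f(3)]]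
      note ml = linear_familyD[OF \<pi>_linear f(2)] linear_familyD[OF \<rho>_linear f(3)]
      note pk = bilinear_set_prod[OF monoid_k f(4,5) sets(3) sets(1)[symmetric]]
      note ph = bilinear_set_prod[OF monoid_h f(6,7) sets(4) sets(2)[symmetric]]
      have Dx: "comul h T x (S' - S) \<in> snd (tensor_product (val h (S' - S)) (val h (T - S')))"
        using cauchy_component[OF comul_in[OF fin(2) xh] sets(5)] sets(7) by simp
      have Db: "comul h S b (S \<inter> S') \<in> snd (tensor_product (val h (S \<inter> S')) (val h (S - S')))"
        using cauchy_component[OF comul_in[OF fin(1) b], of "S \<inter> S'"] sets(8) by simp
      have inner: "comul h T x (S' - S) (\<lambda>x1 x2. B (\<pi> S' (set_prod h (S \<inter> S') (S' - S) b1 x1))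
                    (\<rho> (S \<union> T - S') (set_prod h (S - S') (T - S') b2 x2))) = 0"
        if b1: "b1 \<in> obj h (S \<inter> S')" and b2: "b2 \<in> obj h (S - S')" for b1 b2
      proof -
        have \<pi>b1: "\<pi> (S \<inter> S') b1 \<in> obj k (S \<inter> S')"
          using linear_mapD(1)[OF linear_familyD[OF \<pi>_linear f(4)]] b1 by simp
        \<comment> \<open>Multiplicativity of \<open>\<pi>\<close> lets \<open>x1\<close> enter only
          through \<open>\<pi> (S' - S) x1\<close>, which turns the coproduct of \<open>x\<close>
          into its coaction.\<close>
        let ?C = "\<lambda>c x2. B (set_prod k (S \<inter> S') (S' - S) (\<pi> (S \<inter> S') b1) c)
                    (\<rho> (S \<union> T - S') (set_prod h (S - S') (T - S') b2 x2))"
        have C: "bilinear_form (val k (S' - S)) (val h (T - S')) ?C"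
          by (rule bilinear_map_comp[OF B bilinear_map_linear_right[OF pk] linear_map_comp[OF bilinear_map_linear_right[OF ph] ml(2)]])
            (use \<pi>b1 b2 in simp_all)
        have "comul h T x (S' - S) (\<lambda>x1 x2. B (\<pi> S' (set_prod h (S \<inter> S') (S' - S) b1 x1))
                    (\<rho> (S \<union> T - S') (set_prod h (S - S') (T - S') b2 x2))) =
              comul h T x (S' - S) (\<lambda>x1 x2. ?C (\<pi> (S' - S) x1) x2)"
          by (rule tensor_apply_cong[OF vsp_familyD[OF h_families(4) f(5)] vsp_familyD[OF h_families(4) f(7)] Dx])
            (use \<pi>_set_prod[OF f(4,5) sets(3) b1] in \<open>simp add: sets\<close>)
        also have "\<dots> = \<delta> T x (S' - S) ?C"
          using C sets(5) by (simp add: induced_coaction_def cauchy_map_def tensor_map_def sets(7))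
        also have "\<dots> = 0" using x sets(5,6) by (simp add: Hker_iff[OF fin(2)])
        finally show ?thesis .
      qed
      have "\<phi> (S \<union> T) (set_prod h S T b x) S' B =
            comul h S b (S \<inter> S') (\<lambda>b1 b2. comul h T x (S' - S) (\<lambda>x1 x2. B (\<pi> S' (set_prod h (S \<inter> S') (S' - S) b1 x1))
                    (\<rho> (S \<union> T - S') (set_prod h (S - S') (T - S') b2 x2))))"
        by (simp add: \<phi>_apply[OF f(1) True B] comul_set_prod[OF h fin disj b xh True B'])
      also have "\<dots> = comul h S b (S \<inter> S') (\<lambda>b1 b2. 0)"
        by (rule tensor_apply_cong[OF vsp_familyD[OF h_families(4) f(4)] vsp_familyD[OF h_families(4) f(6)] Db]) (simp add: inner)
      also have "\<dots> = 0" by (rule tensor_apply_zero[OF Db])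
      finally show ?thesis by simp
    qed
  qed
qed

text \<open>For \<open>S' = S\<close> the factor \<open>b\<close> is cut at the full set and
  \<open>x\<close> at the empty set, so by connectedness the parts are \<open>b \<otimes> e\<close>
  and \<open>e \<otimes> x\<close>. The products collapse by the unit laws, and
  \<open>\<rho>\<close> fixes \<open>x\<close>.\<close>

lemma \<phi>_set_prod_top:
  assumes fin: "finite S" "finite T" and disj: "S \<inter> T = {}"
    and b: "b \<in> obj h S" and x: "x \<in> obj K T"
  shows "\<phi> (S \<union> T) (set_prod h S T b x) S = pure_tensor (val k S) (val K T) (\<pi> S b) x"
proof
  fix B
  have d: "S \<union> T - S = T" "S - S = {}" "T - S = T" using disj by auto
  have f: "finite (S \<union> T)" "S \<subseteq> S \<union> T" using fin by auto
  show "\<phi> (S \<union> T) (set_prod h S T b x) S B = pure_tensor (val k S) (val K T) (\<pi> S b) x B"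
  proof (cases "bilinear_form (val k S) (val K T) B")
    case False
    then show ?thesis by (simp add: \<phi>_def cauchy_map_def tensor_map_def pure_tensor_def d)
  next
    case B: True
    have xh: "x \<in> obj h T" using x Hker_subset by auto
    note ml = linear_familyD[OF \<pi>_linear fin(1)] linear_familyD[OF \<rho>_linear fin(2)]
    note B' = bilinear_map_comp[OF B ml]
    note pS = bilinear_set_prod[OF monoid_h fin(1) finite.emptyI Int_empty_right Un_empty_right[symmetric]]
    note pT = bilinear_set_prod[OF monoid_h finite.emptyI fin(2) Int_empty_left Un_empty_left[symmetric]]
    note lS = linear_map_comp[OF bilinear_map_linear_left[OF pS] ml(1)] linear_map_comp[OF bilinear_map_linear_right[OF pS] ml(1)]
    note lT = linear_map_comp[OF bilinear_map_linear_left[OF pT] ml(2)] linear_map_comp[OF bilinear_map_linear_right[OF pT] ml(2)]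
    let ?F = "\<lambda>b1 b2 x1 x2. B (\<pi> S (set_prod h S {} b1 x1)) (\<rho> T (set_prod h {} T b2 x2))"
    have Db: "comul h S b S \<in> snd (tensor_product (val h S) (val h {}))"
      using cauchy_component[OF comul_in[OF fin(1) b], of S] by simp
    have "\<phi> (S \<union> T) (set_prod h S T b x) S B = comul h S b S (\<lambda>b1 b2. comul h T x {} (?F b1 b2))"
      using comul_set_prod[OF h fin disj b xh f(2), of "\<lambda>a y. B (\<pi> S a) (\<rho> T y)"] B B'
      by (simp add: \<phi>_apply[OF f] d)
    also have "\<dots> = comul h S b S (\<lambda>b1 b2. ?F b1 b2 e x)"
    proof (rule tensor_apply_cong[OF vsp_familyD[OF h_families(4) fin(1)] vsp_familyD[OF h_families(4)] Db])
      fix b1 b2 assume "b1 \<in> snd (val h S)" "b2 \<in> snd (val h {})"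
      then have C: "bilinear_form (val h {}) (val h T) (?F b1 b2)"
        by (intro bilinear_map_comp[OF B lS(2) lT(2)])
      show "comul h T x {} (?F b1 b2) = ?F b1 b2 e x"
        by (rule comul_empty_left[OF comonoid_h fin(2) xh unit_in empty_eq C])
    qed simp
    also have "\<dots> = ?F b e e x"
      by (rule comul_empty_right[OF comonoid_h fin(1) b unit_in empty_eq])
        (use unit_in xh in \<open>auto intro!: bilinear_map_comp[OF B lS(1) lT(1)]\<close>)
    also have "\<dots> = B (\<pi> S b) x"
      by (simp add: set_prod_unit_left[OF monoid_h fin(2) xh] set_prod_unit_right[OF monoid_h fin(1) b] \<rho>_id[OF fin(2) x])
    finally show ?thesis using B by (simp add: pure_tensor_def)
  qed
qed

section \<open>Bijectivity of the comparison map\<close>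

lemma \<phi>_surj:
  assumes I: "finite I"
  shows "\<phi> I ` obj h I = obj (cauchy k K) I"
proof
  note l = linear_familyD[OF \<phi>_linear I] and v = vsp_familyD[OF h_families(4) I]
  note \<phi>D = linear_mapD[OF l, unfolded snd_conv fst_conv] and cl = is_vsp_closed[OF v, unfolded snd_conv fst_conv]
  let ?M = "\<phi> I ` obj h I"
  show "?M \<subseteq> obj (cauchy k K) I" using \<phi>D(1) by auto
  interpret vector_space "scl (cauchy k K)" using is_vsp_cauchy by (auto simp: is_vsp_def)
  have M: "subspace ?M"
  proof (rule subspaceI)
    show "0 \<in> ?M" using linear_map_0[OF v l] cl(1) by (metis imageI)
    show "x + y \<in> ?M" if xy: "x \<in> ?M" "y \<in> ?M" for x y
    proof -
      obtain a b where "a \<in> obj h I" "b \<in> obj h I" "x = \<phi> I a" "y = \<phi> I b" using xy by blast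
      then show ?thesis using \<phi>D(2)[of a b] cl(2)[of a b] by (metis imageI)
    qed
    show "scl (cauchy k K) c x \<in> ?M" if xM: "x \<in> ?M" for c x
    proof -
      obtain a where "a \<in> obj h I" "x = \<phi> I a" using xM by blast
      then show ?thesis using \<phi>D(3)[of a c] cl(3)[of a c] by (metis imageI)
    qed
  qed
  \<comment> \<open>Induction on the cardinality of \<open>S\<close>, with \<open>u\<close>
    arbitrary: the lower terms to be subtracted need not be pure tensors.\<close>
  have summand: "summand S u \<in> ?M" if "S \<subseteq> I" "u \<in> snd (tensor_product (val k S) (val K (I - S)))" for S u
    using that
  proof (induction "card S" arbitrary: S u rule: less_induct)
    case less
    note S = less.prems(1)
    have fin: "finite S" "finite (I - S)" using finite_subset[OF S I] I by auto
    have disj: "S \<inter> (I - S) = {}" and un: "S \<union> (I - S) = I" using S by auto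
    from less.prems(2) show ?case
    proof (induction rule: tensor_induct)
      case zero
      then show ?case using subspace_0[OF M] by (simp only: summand_zero)
    next
      case (add t u)
      then show ?case using subspace_add[OF M] by (simp only: summand_add)
    next
      case (scale c t)
      then show ?case using subspace_scale[OF M] by (simp only: summand_scale[of _ _ _ k K])
    next
      case (pure a x)
      then obtain b where b: "b \<in> obj h S" "a = \<pi> S b"
        using surj fin(1) by (auto simp: surjective_morphism_def)
      have x: "x \<in> obj K (I - S)" using pure by simp
      then have xh: "x \<in> obj h (I - S)" using Hker_subset by auto
      define y where "y = set_prod h S (I - S) b x"
      have y: "y \<in> obj h I"
        using bilinear_mapD(1)[OF bilinear_set_prod[OF monoid_h fin disj un[symmetric]]] b xh by (simp add: y_def)
      let ?A = "{S'. S' \<subset> S}"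
      have fA: "finite ?A" using fin(1) by (intro finite_subset[of ?A "Pow S"]) auto
      have "summand S' (\<phi> I y S') \<in> ?M" if "S' \<in> ?A" for S'
      proof (rule less.hyps)
        show "card S' < card S" using that fin(1) psubset_card_mono by auto
        show "S' \<subseteq> I" using that S by auto
        then show "\<phi> I y S' \<in> snd (tensor_product (val k S') (val K (I - S')))"
          by (rule cauchy_component[OF \<phi>D(1)[OF y]])
      qed
      then have sumM: "(\<Sum>S'\<in>?A. summand S' (\<phi> I y S')) \<in> ?M" by (rule subspace_sum[OF M])
      have top: "\<phi> I y S = pure_tensor (val k S) (val K (I - S)) a x"
        using \<phi>_set_prod_top[OF fin disj b(1) x] by (simp only: un y_def b(2))
      have out: "\<phi> I y S' = 0" if "\<not> S' \<subseteq> S" for S'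
        using \<phi>_set_prod_outside[OF fin disj b(1) x that] by (simp only: un y_def)
      \<comment> \<open>The triangular decomposition: the wanted summand plus terms at proper
        subsets of \<open>S\<close>, already in the image by induction.\<close>
      have "\<phi> I y = summand S (pure_tensor (val k S) (val K (I - S)) a x) + (\<Sum>S'\<in>?A. summand S' (\<phi> I y S'))"
      proof
        fix S'
        show "\<phi> I y S' = (summand S (pure_tensor (val k S) (val K (I - S)) a x) + (\<Sum>S'\<in>?A. summand S' (\<phi> I y S'))) S'"
          using top out[of S'] by (cases "S' = S"; cases "S' \<subseteq> S") (simp_all add: sum_summand[OF fA], auto simp: summand_def)
      qed
      from this[symmetric]
      have "summand S (pure_tensor (val k S) (val K (I - S)) a x) = \<phi> I y - (\<Sum>S'\<in>?A. summand S' (\<phi> I y S'))"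
        by (simp only: eq_diff_eq)
      then show ?case using subspace_diff[OF M imageI[OF y] sumM] by (simp only:)
    qed
  qed
  show "obj (cauchy k K) I \<subseteq> ?M"
  proof
    fix t assume t: "t \<in> obj (cauchy k K) I"
    have "(\<Sum>S\<in>Pow I. summand S (t S)) \<in> ?M"
      by (rule subspace_sum[OF M]) (use summand cauchy_component[OF t] in auto)
    also have "(\<Sum>S\<in>Pow I. summand S (t S)) = t"
      using sum_summand[of "Pow I" t] I cauchy_outside[OF t] by (simp only: finite_Pow_iff) (intro ext, auto)
    finally show "t \<in> ?M" .
  qed
qed

lemma \<phi>_inj:
  assumes "finite I"
  shows "inj_on (\<phi> I) (obj h I)"
  using assms
proof (induction "card I" arbitrary: I rule: less_induct)
  case less
  note I = less.prems
  note l = linear_familyD[OF \<phi>_linear I] and v = vsp_familyD[OF h_families(4) I]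
  have ker: "x = 0" if x: "x \<in> obj h I" and 0: "\<phi> I x = 0" for x
  proof -
    have "\<delta> I x S = 0" if S: "S \<subseteq> I" "S \<noteq> {}" for S
    proof -
      let ?T = "I - S"
      \<comment> \<open>\<open>tensor_map_comp\<close> asks for a linear map on all of
        \<open>(k \<cdot> K)[?T]\<close>; surjectivity of \<open>\<phi>\<close> makes this inverse
        one.\<close>
      let ?g = "inv_into (obj h ?T) (\<phi> ?T)"
      have f: "finite S" "finite ?T" using finite_subset[OF S(1) I] I by auto
      have "card ?T < card I" using S I by (intro psubset_card_mono) auto
      then have inj: "inj_on (\<phi> ?T) (obj h ?T)" using less.hyps f(2) by blast
      have g: "linear_map (val (cauchy k K) ?T) (val h ?T) ?g"
        using linear_map_inv_into[OF vsp_familyD[OF h_families(4) f(2)] linear_familyD[OF \<phi>_linear f(2)]] inj \<phi>_surj[OF f(2)]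
        by (simp add: bij_betw_def)
      note \<delta>S = cauchy_component[OF coaction_in[OF I x] S(1)]
      have "cauchy_map k (cauchy k K) idm \<phi> I (\<delta> I x) = 0"
        using \<phi>_coaction[OF I x] by (simp add: 0 cofree_coaction_def)
      from fun_cong[OF this, of S]
      have "tensor_map (val k S) (val (cauchy k K) ?T) (\<lambda>x. x) (\<phi> ?T) (\<delta> I x S) = 0"
        using S(1) by (simp add: cauchy_map_def)
      then have "0 = tensor_map (val k S) (val h ?T) (\<lambda>x. x) ?g (tensor_map (val k S) (val (cauchy k K) ?T) (\<lambda>x. x) (\<phi> ?T) (\<delta> I x S))"
        by simp
      also have "\<dots> = tensor_map (val k S) (val h ?T) (\<lambda>x. x) (\<lambda>y. ?g (\<phi> ?T y)) (\<delta> I x S)"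
        by (rule tensor_map_comp[OF linear_map_ident g])
      also have "\<dots> = tensor_map (val k S) (val h ?T) (\<lambda>x. x) (\<lambda>y. y) (\<delta> I x S)"
        by (rule tensor_map_cong[OF vsp_familyD[OF k_families(4) f(1)] vsp_familyD[OF h_families(4) f(2)] \<delta>S]) (simp_all add: inj)
      also have "\<dots> = \<delta> I x S" by (rule tensor_map_ident[OF \<delta>S])
      finally show ?thesis ..
    qed
    then have xK: "x \<in> obj K I" using x by (simp add: Hker_iff[OF I])
    \<comment> \<open>Writing \<open>x\<close> as \<open>e x\<close> makes the leading-term formula
      with \<open>S = {}\<close> applicable to \<open>x\<close> itself.\<close>
    have "\<phi> I (set_prod h {} I e x) {} = pure_tensor (val k {}) (val K I) (\<pi> {} e) x"
      using \<phi>_set_prod_top[OF finite.emptyI I Int_empty_left unit_in xK] by simp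
    then have p0: "pure_tensor (val k {}) (val K I) (\<pi> {} e) x = 0"
      by (simp add: set_prod_unit_left[OF monoid_h I x] 0)
    have \<epsilon>: "linear_map (val k {}) scalar_vsp (counit k {})"
      using linear_familyD[OF k_families(6), of "{}"] by (simp add: unit_species_def)
    have "counit k {} (\<pi> {} e) = 1"
      using \<pi> unit_in bimonoid_unit[OF h] by (simp add: hopf_morphism_def)
    then show "x = 0" by (rule pure_tensor_one_eq_0[OF Hker_vsp[OF I] \<epsilon> _ p0])
  qed
  interpret vector_space "scl h" using v by (simp add: is_vsp_def)
  have sub: "subspace (obj h I)" using v by (simp add: is_vsp_def)
  show ?case
  proof (rule inj_onI)
    fix x y assume x: "x \<in> obj h I" and y: "y \<in> obj h I" and eq: "\<phi> I x = \<phi> I y"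
    have d: "x - y \<in> obj h I" using subspace_diff[OF sub x y] .
    have "\<phi> I x = \<phi> I (x - y) + \<phi> I y"
      using linear_mapD(2)[OF l, of "x - y" y] d y by simp
    then have "\<phi> I (x - y) = 0" using eq by (metis add_cancel_left_left)
    then show "x = y" using ker[OF d] by simp
  qed
qed

lemma \<phi>_isomorphism: "species_isomorphism h (cauchy k K) \<phi>"
  using \<phi>_morphism \<phi>_surj \<phi>_inj by (simp add: species_isomorphism_def bij_betw_def)

end

lemma cofree_Hker:
  "left_comodule_isomorphic k h \<delta> (cauchy k K) (cofree_coaction k K)" (is ?A)
  "species_isomorphic h (cauchy k K)" (is ?B)
proof -
  obtain \<rho> where \<rho>: "species_morphism h K \<rho>" "\<And>I x. finite I \<Longrightarrow> x \<in> obj K I \<Longrightarrow> \<rho> I x = x"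
    using Hker_retraction_exists by blast
  note iso = \<phi>_isomorphism[OF \<rho>] and coact = \<phi>_coaction[OF \<rho>]
  \<comment> \<open>Needed before the comodule structure can be transported, because
    \<open>left_comodule_transfer\<close> takes a species as its target.\<close>
  have sp: "is_species (cauchy k K)"
    by (rule is_species_transfer[OF h_families(1) iso vsp_family_cauchy])
  have "left_comodule k (cauchy k K) (cofree_coaction k K)"
    by (rule left_comodule_transfer[OF comonoid_k coaction_comodule sp iso coact])
  then show ?A using coaction_comodule iso coact unfolding left_comodule_isomorphic_def by blast
  show ?B using h_families(1) sp iso by (auto simp: species_isomorphic_def)
qed

end

theorem theorem2p7:
  fixes h :: "('a::infinite, 'f::field_char_0, 'v::ab_group_add) hopf"
    and k :: "('a, 'f, 'w::ab_group_add) hopf"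
    and \<pi> :: "'a set \<Rightarrow> 'v \<Rightarrow> 'w"
  assumes "is_hopf_monoid h" and "connected_species h"
    and "is_hopf_monoid k"
    and "hopf_morphism h k \<pi>" and "surjective_morphism h k \<pi>"
  shows "cofree_left_comodule k h (induced_coaction h k \<pi>)
    \<and> left_comodule_isomorphic k h (induced_coaction h k \<pi>)
        (cauchy k (Hker h k \<pi>)) (cofree_coaction k (Hker h k \<pi>))
    \<and> species_isomorphic h (cauchy k (Hker h k \<pi>))"
proof -
  interpret bimonoid_quotient h k \<pi>
    using assms by unfold_locales (simp_all add: is_hopf_monoid_def)
  show ?thesis
    \<comment> \<open>The cogenerating species for cofreeness is the Hopf kernel itself.\<close>
    using cofree_Hker Hker_species unfolding cofree_left_comodule_def by blast
qed

end
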